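(* Let $\nu$ be a probability measure on $\mathbb{R}^q$, let $(Y_n)_{n\ge0}$ be a $\nu$-stable sequence, let $p\in[1,\infty)$, and let $(\varepsilon_n)_{n\ge1}$ be a sequence of nonnegative numbers with $\varepsilon_n\to0$ and $\liminf_n n\varepsilon_n>0$. Let $H:\mathbb{R}^d\times\mathbb{R}^q\to\mathbb{R}^d$ be a Borel function with mean function $h(\theta)=\int_{\mathbb{R}^q}H(\theta,y)\,\nu(dy)$, let $\theta^*\in\mathbb{R}^d$, and assume that $$\forall\theta\in\mathbb{R}^d,\ \forall y\in\mathbb{R}^q,\quad H(\theta,y)=\chi(y)h(\theta)+H(\theta^*,y),$$ where $\chi:\mathbb{R}^q\to\mathbb{R}$ is a Borel function with $\int\chi\,d\nu=1$, $\chi\in\mathcal{V}_{\varepsilon_n,p}$ and $\sup_{n\ge0}\|\chi(Y_n)\|_{2\vee\frac{p}{p-1}}<+\infty$; $H(\theta^*,\cdot)\in\mathcal{V}_{\varepsilon_n,p}$ and $\sup_{n\ge0}\|H(\theta^*,Y_n)\|_{2\vee\frac{p}{p-1}}<+\infty$; and $h$ is Lipschitz continuous and bounded with $h(\theta^* )=0$. Let $L:\mathbb{R}^d\to\mathbb{R}_+$ be a continuously differentiable function such that $\nabla L$ is Lipschitz continuous, $|\nabla L|^2\le C(1+L)$ for some constant $C$, and $\lim_{|\theta|\to+\infty}L(\theta)=+\infty$. Assume that, for some constant $C_h$, $|h(\theta)|\le C_h\sqrt{1+L(\theta)}$ for every $\theta\in\mathbb{R}^d$, and that $$\forall\theta\in\mathbb{R}^d\setminus\{\theta^*\},\quad\langle\nabla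 L(\theta)\,|\,h(\theta)\rangle>0 .$$ Assume there are a constant $C_M>0$ and a Borel function $\phi:\mathbb{R}^q\to\mathbb{R}_+$ with $\sup_{n\ge0}\|\phi(Y_n)\|_{2\vee\frac{p}{p-1}}<+\infty$ such that for every $n\ge0$, $\mathbb{P}$-a.s., $$\mathbb{E}\big(|\Delta M_{n+1}|^{2\vee\frac{p}{p-1}}\,\big|\,\mathcal{F}_n\big)\le C_M\,\phi(Y_n)^{2\vee\frac{p}{p-1}}(1+L(\theta_n))^{1\vee\frac{p}{2(p-1)}}\ \text{ if }p>1,\qquad \frac{|\Delta M_{n+1}|}{(1+L(\theta_n))^{\frac12}}\le C_M\ \text{ if }p=1 .$$ Let $(\gamma_n)_{n\ge1}$ be a nonnegative non-increasing sequence such that $\sum_{n\ge1}\gamma_n=+\infty$, $n\varepsilon_n\gamma_n\to0$ and $\sum_{n\ge1}n\varepsilon_n\max(\gamma_n^2,|\Delta\gamma_{n+1}|)<+\infty$. Then the recursive procedure $$\theta_{n+1}=\theta_n-\gamma_{n+1}\big(H(\theta_n,Y_n)+\Delta M_{n+1}\big),\quad n\ge0,$$ satisfies $\theta_n\to\theta^*$ a.s. as $n\to\infty$.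
   Context: All random variables are defined on a filtered probability space $(\Omega,\mathcal{F},(\mathcal{F}_n)_{n\ge0},\mathbb{P})$. $(Y_n)_{n\ge0}$ is an $\mathbb{R}^q$-valued $(\mathcal{F}_n)$-adapted sequence; $(\Delta M_n)_{n\ge1}$ is a sequence of $\mathbb{R}^d$-valued $(\mathcal{F}_n)$-adapted martingale increments (integrable, with $\mathbb{E}[\Delta M_{n+1}\mid\mathcal{F}_n]=0$); $\theta_0$ is $\mathbb{R}^d$-valued, $\mathcal{F}_0$-measurable, in $L^1(\mathbb{P})$, and independent of $(Y_n,\Delta M_{n+1})_{n\ge0}$. $(Y_n)$ is $\nu$-stable (equivalently $\nu$-averaging) if, almost surely, $\frac1n\sum_{k=0}^{n-1}\delta_{Y_k}$ converges weakly to $\nu$ as $n\to\infty$. $\mathcal{V}_{\varepsilon_n,p}$ is the class of functions $f\in L^p(\nu)$ such that $\frac1n\sum_{k=0}^{n-1}f(Y_k)-\int f\,d\nu=O(\varepsilon_n)$ both $\mathbb{P}$-a.s. (with a possibly random constant) and in $L^p(\mathbb{P})$ (i.e. the $L^p(\mathbb{P})$-norm of the left side is $O(\varepsilon_n)$); for $\mathbb{R}^d$-valued $f$ this is understood componentwise. Conventions: $\langle\cdot|\cdot\rangle$ and $|\cdot|$ are the Euclidean inner product and norm; $\|\cdot\|_r$ is the $L^r(\mathbb{P})$-norm; $\frac{p}{p-1}=+\infty$ if $p=1$; $a\vee b=\max(a,b)$; $\Delta a_n=a_n-a_{n-1}$ for any sequence $(a_n)$. *)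

theory Defs
  imports "HOL-Probability.Probability"
begin

text \<open>
  The \<open>L\<^sup>r\<close>-norm for \<open>r \<in> ]0, \<infinity>]\<close>, with values in \<open>[0, \<infinity>]\<close>, so that finiteness of the norm
  is a genuine condition and not an artefact of a Bochner integral that defaults to 0.
\<close>

definition Lr_norm :: "'a measure \<Rightarrow> ennreal \<Rightarrow> ('a \<Rightarrow> 'b::real_normed_vector) \<Rightarrow> ennreal" where
  "Lr_norm M r f =
    (if r = \<infinity> then esssup M (\<lambda>x. ennreal (norm (f x)))
     else (let s = enn2real r; I = (\<integral>\<^sup>+ x. ennreal (norm (f x) powr s) \<partial>M)
           in if I = \<infinity> then \<infinity> else ennreal (enn2real I powr (1 / s))))"

definition conj_exponent :: "real \<Rightarrow> ennreal" where
  "conj_exponent p = (if p = 1 then \<infinity> else ennreal (p / (p - 1)))"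

text \<open>
  Independence of \<open>X\<close> and \<open>Z\<close> through the \<open>\<sigma>\<close>-algebras they generate, as for \<open>indep_var\<close>, which
  however forces \<open>X\<close> and \<open>Z\<close> to have values in the same type.
\<close>

definition indep_random_variables ::
    "'a measure \<Rightarrow> 'b measure \<Rightarrow> ('a \<Rightarrow> 'b) \<Rightarrow> 'c measure \<Rightarrow> ('a \<Rightarrow> 'c) \<Rightarrow> bool" where
  "indep_random_variables M S X T Z \<longleftrightarrow>
    X \<in> measurable M S \<and> Z \<in> measurable M T \<and>
    prob_space.indep_set M (sets (vimage_algebra (space M) X S)) (sets (vimage_algebra (space M) Z T))"

definition weakly_converges :: "(nat \<Rightarrow> 'b::topological_space measure) \<Rightarrow> 'b measure \<Rightarrow> bool" where
  "weakly_converges \<mu> \<nu> \<longleftrightarrow>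
    (\<forall>f::'b \<Rightarrow> real. continuous_on UNIV f \<longrightarrow> bounded (range f) \<longrightarrow>
      (\<lambda>n. \<integral>y. f y \<partial>\<mu> n) \<longlonglongrightarrow> (\<integral>y. f y \<partial>\<nu>))"

text \<open>
  The measure \<open>(1/n) (\<delta>\<^bsub>y 0\<^esub> + \<dots> + \<delta>\<^bsub>y (n-1)\<^esub>)\<close>, as the image of the uniform distribution on
  \<open>{0, \<dots>, n-1}\<close> under \<open>y\<close>; see \<open>emeasure_empirical_measure\<close>. Only \<open>n \<ge> 1\<close> is meaningful.
\<close>

definition empirical_measure :: "(nat \<Rightarrow> 'b::topological_space) \<Rightarrow> nat \<Rightarrow> 'b measure" where
  "empirical_measure y n = distr (uniform_count_measure {..<n}) borel y"

lemma emeasure_empirical_measure: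
  assumes "n \<ge> 1" "A \<in> sets borel"
  shows "emeasure (empirical_measure y n) A = ennreal ((\<Sum>k<n. indicator A (y k)) / real n)"
proof -
  have m: "y \<in> measurable (uniform_count_measure {..<n}) borel"
    by (simp add: measurable_def space_uniform_count_measure sets_uniform_count_measure)
  have c: "emeasure (uniform_count_measure {..<n}) {k. k < n \<and> y k \<in> A} =
      ennreal (real (card {k. k < n \<and> y k \<in> A}) / real n)"
    by (subst emeasure_uniform_count_measure) auto
  have e: "y -` A \<inter> {..<n} = {k \<in> {..<n}. y k \<in> A}" by auto
  have "(\<Sum>k<n. indicator A (y k)) = real (card {k \<in> {..<n}. y k \<in> A})"
    by (simp add: indicator_def sum.If_cases Int_def)
  then show ?thesis
    using assms unfolding empirical_measure_def
    by (simp add: emeasure_distr[OF m] space_uniform_count_measure e c)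
qed

text \<open>\<open>Y\<close> is \<open>\<nu>\<close>-stable, i.e. \<open>\<nu>\<close>-averaging, under the probability \<open>M\<close>.\<close>

definition averaging :: "'a measure \<Rightarrow> (nat \<Rightarrow> 'a \<Rightarrow> 'b::topological_space) \<Rightarrow> 'b measure \<Rightarrow> bool" where
  "averaging M Y \<nu> \<longleftrightarrow>
    (AE \<omega> in M. weakly_converges (\<lambda>n. empirical_measure (\<lambda>k. Y k \<omega>) n) \<nu>)"

definition averaging_error ::
    "(nat \<Rightarrow> 'a \<Rightarrow> 'b) \<Rightarrow> 'b measure \<Rightarrow> ('b \<Rightarrow> real) \<Rightarrow> nat \<Rightarrow> 'a \<Rightarrow> real" where
  "averaging_error Y \<nu> f n \<omega> = (\<Sum>k<n. f (Y k \<omega>)) / real n - (\<integral>y. f y \<partial>\<nu>)"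

text \<open>
  The class \<open>V\<close> of functions averaged at rate \<open>\<epsilon>\<close>, almost surely and in \<open>L\<^sup>p\<close>. The second \<open>O\<close> is
  spelled out because the norm is extended-valued.
\<close>

definition averaging_class ::
    "'a measure \<Rightarrow> (nat \<Rightarrow> 'a \<Rightarrow> 'b) \<Rightarrow> 'b measure \<Rightarrow> (nat \<Rightarrow> real) \<Rightarrow> real \<Rightarrow> ('b \<Rightarrow> real) set" where
  "averaging_class M Y \<nu> \<epsilon> p =
    {f. f \<in> borel_measurable \<nu> \<and> Lr_norm \<nu> (ennreal p) f < \<infinity> \<and>
        (AE \<omega> in M. (\<lambda>n. averaging_error Y \<nu> f n \<omega>) \<in> O(\<epsilon>)) \<and>
        (\<exists>C. \<forall>\<^sub>F n in sequentially.
           Lr_norm M (ennreal p) (averaging_error Y \<nu> f n) \<le> ennreal (C * \<epsilon> n))}"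

end

theory Submission
  imports Defs
begin

text \<open>
  The descent is measured by \<open>ln (1 + L)\<close> rather than by \<open>L\<close>. Write \<open>s = sqrt (1 + L)\<close> and let
  \<open>u = \<nabla>L / (1 + L)\<close> be the gradient of \<open>ln (1 + L)\<close>. A second-order expansion along the recursion gives
  \<open>ln (1 + L (\<theta>\<^bsub>n+1\<^esub>)) \<le> ln (1 + L (\<theta>\<^sub>n)) - \<gamma>\<^bsub>n+1\<^esub> \<langle>u|h\<rangle>(\<theta>\<^sub>n) + d\<^sub>n\<close>,
  where \<open>\<langle>u|h\<rangle>\<close> is nonnegative and vanishes only at \<open>\<theta>\<^sup>*\<close>, and where \<open>d\<^sub>n\<close> collects, up to the factor
  \<open>-\<gamma>\<^bsub>n+1\<^esub>\<close>, the terms \<open>(\<chi>(Y\<^sub>n) - 1) \<langle>u|h\<rangle>(\<theta>\<^sub>n)\<close>, \<open>\<langle>u(\<theta>\<^sub>n)|H(\<theta>\<^sup>*,Y\<^sub>n)\<rangle>\<close> and \<open>\<langle>u(\<theta>\<^sub>n)|\<Delta>M\<^bsub>n+1\<^esub>\<rangle>\<close>,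
  together with the quadratic remainder.

  The gain of the logarithm is that all increments appear divided by \<open>s(\<theta>\<^sub>n)\<close>. With
  \<open>\<zeta>\<^sub>n = B |\<chi>(Y\<^sub>n)| + |H(\<theta>\<^sup>*,Y\<^sub>n)| + |\<Delta>M\<^bsub>n+1\<^esub>| / s(\<theta>\<^sub>n)\<close>, where \<open>B\<close> bounds \<open>|h|\<close>, the step from \<open>\<theta>\<^sub>n\<close> to
  \<open>\<theta>\<^bsub>n+1\<^esub>\<close> has length at most \<open>\<gamma>\<^bsub>n+1\<^esub> s(\<theta>\<^sub>n) \<zeta>\<^sub>n\<close>, and the moment conditions bound \<open>E \<zeta>\<^sub>n\<^sup>2\<close>
  uniformly in \<open>n\<close>, however large \<open>\<theta>\<^sub>n\<close> may be. Hence no stability of \<open>(\<theta>\<^sub>n)\<close> has to be known, and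
  \<open>L(\<theta>\<^sub>0)\<close> may have infinite expectation. The series of the \<open>d\<^sub>n\<close> converges almost surely, part by part.

  \<^item> The quadratic remainder is at most a constant times \<open>\<gamma>\<^bsub>n+1\<^esub>\<^sup>2 \<zeta>\<^sub>n\<^sup>2\<close>, and its expectations are
    summable because \<open>\<Sum> \<gamma>\<^sub>n\<^sup>2 < \<infinity>\<close>.
  \<^item> The terms with \<open>\<Delta>M\<close> are martingale differences with summable second moments; their series
    converges by Kolmogorov's maximal inequality (\<open>martingale_differences.AE_summable\<close>).
  \<^item> The partial sums of \<open>\<chi>(Y\<^sub>n) - 1\<close> and of \<open>H(\<theta>\<^sup>*,Y\<^sub>n)\<close> are \<open>O(n \<epsilon>\<^sub>n)\<close>. Their weights
    \<open>\<langle>u|h\<rangle>(\<theta>\<^sub>n)\<close> and \<open>u(\<theta>\<^sub>n)\<close> are bounded and change by at most a constant times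
    \<open>\<gamma>\<^bsub>n+1\<^esub> \<zeta>\<^sub>n\<close> per step, so that summation by parts
    (\<open>summable_eventually_bounded_partial_sums\<close>) leaves the series of the
    \<open>n \<epsilon>\<^sub>n |\<Delta>\<gamma>\<^bsub>n+1\<^esub>|\<close> and of the \<open>n \<epsilon>\<^sub>n \<gamma>\<^sub>n\<^sup>2 \<zeta>\<^bsub>n-1\<^esub>\<close>.

  Consequently \<open>L(\<theta>\<^sub>n)\<close> converges and \<open>\<Sum> \<gamma>\<^bsub>n+1\<^esub> \<langle>u|h\<rangle>(\<theta>\<^sub>n) < \<infinity>\<close>. As the steps sum to infinity,
  \<open>\<langle>u|h\<rangle>(\<theta>\<^sub>n)\<close> comes arbitrarily close to 0, which makes \<open>\<theta>\<^sup>*\<close> a cluster point. The limit of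
  \<open>L(\<theta>\<^sub>n)\<close> is therefore \<open>L(\<theta>\<^sup>*)\<close>, which is the minimum of \<open>L\<close> and is attained at no other point; so
  \<open>\<theta>\<^sup>*\<close> is the only cluster point (\<open>mean_reverting_field.trajectory_tendsto\<close>).
\<close>

section \<open>Summation by parts\<close>

lemma summation_by_parts:
  fixes x b :: "nat \<Rightarrow> real"
  shows "(\<Sum>k<n. x k * b k) =
    x n * (\<Sum>j<n. b j) - (\<Sum>k<n. (x (Suc k) - x k) * (\<Sum>j<Suc k. b j))"
  by (induction n) (simp_all add: algebra_simps)

text \<open>
  A criterion of Abel type: the terms \<open>b\<^sub>n\<close> need not tend to 0, only their partial sums are
  controlled, by \<open>w\<^sub>n\<close>. The weights \<open>\<gamma>\<^bsub>n+1\<^esub> u\<^sub>n\<close> vary by at most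
  \<open>U |\<Delta>\<gamma>\<^bsub>n+2\<^esub>| + \<gamma>\<^bsub>n+1\<^esub>\<^sup>2 z\<^sub>n\<close>, and both parts are summable against \<open>w\<close>.
\<close>

lemma summable_eventually_bounded_partial_sums:
  fixes u b w z \<gamma> :: "nat \<Rightarrow> real"
  assumes B: "\<forall>\<^sub>F n in sequentially. \<bar>\<Sum>j<n. b j\<bar> \<le> c * w n"
    and u: "\<And>n. \<bar>u n\<bar> \<le> U"
    and u_step: "\<And>n. \<bar>u (Suc n) - u n\<bar> \<le> \<gamma> (Suc n) * z n"
    and \<gamma>_nonneg: "\<And>n. n \<ge> 1 \<Longrightarrow> 0 \<le> \<gamma> n"
    and \<gamma>_decreasing: "\<And>n. n \<ge> 1 \<Longrightarrow> \<gamma> (Suc n) \<le> \<gamma> n"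
    and \<gamma>_lim: "(\<lambda>n. w n * \<gamma> n) \<longlonglongrightarrow> 0"
    and var: "summable (\<lambda>n. w (Suc n) * \<bar>\<gamma> (Suc (Suc n)) - \<gamma> (Suc n)\<bar>)"
    and sq: "summable (\<lambda>n. w (Suc n) * (\<gamma> (Suc n))\<^sup>2 * z n)"
  shows "summable (\<lambda>n. \<gamma> (Suc n) * u n * b n)"
proof -
  define x where "x n = \<gamma> (Suc n) * u n" for n
  let ?B = "\<lambda>n. \<Sum>j<n. b j"
  have U: "U \<ge> 0" using u[of 0] by linarith
  have x_abs: "\<bar>x n\<bar> \<le> \<gamma> n * U" if "n \<ge> 1" for n
    unfolding x_def abs_mult using \<gamma>_nonneg[of "Suc n"] \<gamma>_decreasing[OF that] u[of n] \<gamma>_nonneg[OF that]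
    by (intro mult_mono) auto
  have end_lim: "(\<lambda>n. x n * ?B n) \<longlonglongrightarrow> 0"
  proof (rule Lim_null_comparison)
    show "\<forall>\<^sub>F n in sequentially. norm (x n * ?B n) \<le> U * c * (w n * \<gamma> n)"
      using B eventually_ge_at_top[of "1::nat"]
    proof eventually_elim
      case (elim n)
      have "\<bar>x n\<bar> * \<bar>?B n\<bar> \<le> (\<gamma> n * U) * (c * w n)"
        using x_abs[OF elim(2)] elim(1) \<gamma>_nonneg[OF elim(2)] U by (intro mult_mono) auto
      then show ?case by (simp add: abs_mult mult_ac)
    qed
    show "(\<lambda>n. U * c * (w n * \<gamma> n)) \<longlonglongrightarrow> 0" using tendsto_mult_right_zero[OF \<gamma>_lim] by simp
  qed
  have "summable (\<lambda>n. (x (Suc n) - x n) * ?B (Suc n))"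
  proof (rule summable_comparison_test_ev)
    show "summable (\<lambda>n. c * U * (w (Suc n) * \<bar>\<gamma> (Suc (Suc n)) - \<gamma> (Suc n)\<bar>)
        + c * (w (Suc n) * (\<gamma> (Suc n))\<^sup>2 * z n))"
      by (intro summable_add summable_mult var sq)
    have "\<forall>\<^sub>F n in sequentially. \<bar>?B (Suc n)\<bar> \<le> c * w (Suc n)"
      using B by (simp only: eventually_sequentially_Suc[of "\<lambda>n. \<bar>?B n\<bar> \<le> c * w n"])
    then show "\<forall>\<^sub>F n in sequentially. norm ((x (Suc n) - x n) * ?B (Suc n))
        \<le> c * U * (w (Suc n) * \<bar>\<gamma> (Suc (Suc n)) - \<gamma> (Suc n)\<bar>)
           + c * (w (Suc n) * (\<gamma> (Suc n))\<^sup>2 * z n)"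
    proof eventually_elim
      case (elim n)
      let ?D = "\<bar>\<gamma> (Suc (Suc n)) - \<gamma> (Suc n)\<bar>"
      have "x (Suc n) - x n = (\<gamma> (Suc (Suc n)) - \<gamma> (Suc n)) * u (Suc n) + \<gamma> (Suc n) * (u (Suc n) - u n)"
        by (simp add: x_def algebra_simps)
      also have "\<bar>\<dots>\<bar> \<le> ?D * U + \<gamma> (Suc n) * (\<gamma> (Suc n) * z n)"
      proof (rule order.trans[OF abs_triangle_ineq], rule add_mono)
        show "\<bar>(\<gamma> (Suc (Suc n)) - \<gamma> (Suc n)) * u (Suc n)\<bar> \<le> ?D * U"
          using u[of "Suc n"] by (simp add: abs_mult mult_left_mono)
        show "\<bar>\<gamma> (Suc n) * (u (Suc n) - u n)\<bar> \<le> \<gamma> (Suc n) * (\<gamma> (Suc n) * z n)"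
          using u_step[of n] \<gamma>_nonneg[of "Suc n"] by (simp add: abs_mult mult_left_mono)
      qed
      finally have "\<bar>x (Suc n) - x n\<bar> * \<bar>?B (Suc n)\<bar>
          \<le> (?D * U + \<gamma> (Suc n) * (\<gamma> (Suc n) * z n)) * (c * w (Suc n))"
        using elim by (intro mult_mono) auto
      also have "\<dots> = c * U * (w (Suc n) * ?D) + c * (w (Suc n) * (\<gamma> (Suc n))\<^sup>2 * z n)"
        by (simp add: algebra_simps power2_eq_square)
      finally show ?case by (simp only: real_norm_def abs_mult)
    qed
  qed
  then have "(\<lambda>n. x n * ?B n - (\<Sum>k<n. (x (Suc k) - x k) * ?B (Suc k)))
      \<longlonglongrightarrow> 0 - (\<Sum>k. (x (Suc k) - x k) * ?B (Suc k))"
    by (intro tendsto_diff end_lim summable_LIMSEQ)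
  then have "(\<lambda>n. \<Sum>k<n. x k * b k) \<longlonglongrightarrow> 0 - (\<Sum>k. (x (Suc k) - x k) * ?B (Suc k))"
    by (simp only: summation_by_parts[of x b])
  then show ?thesis
    unfolding summable_iff_convergent convergent_def x_def by blast
qed

section \<open>The logarithm of a Lyapunov function\<close>

lemma GDERIV_mean_value:
  fixes f :: "'v::real_inner \<Rightarrow> real"
  assumes "\<And>x. GDERIV f x :> G x"
  shows "\<exists>z. norm (z - x) \<le> norm (y - x) \<and> f y - f x = inner (G z) (y - x)"
proof -
  have "((\<lambda>t. f (x + t *\<^sub>R (y - x))) has_derivative (\<lambda>d. inner (d *\<^sub>R (y - x)) (G (x + t *\<^sub>R (y - x)))))
      (at t within {0..1})" for t
  proof (rule has_derivative_compose[of "\<lambda>t. x + t *\<^sub>R (y - x)" "\<lambda>d. d *\<^sub>R (y - x)" _ _ f])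
    show "((\<lambda>t. x + t *\<^sub>R (y - x)) has_derivative (\<lambda>d. d *\<^sub>R (y - x))) (at t within {0..1})"
      by (auto intro!: derivative_eq_intros)
    show "FDERIV f (x + t *\<^sub>R (y - x)) :> (\<lambda>a. inner a (G (x + t *\<^sub>R (y - x))))"
      using assms unfolding gderiv_def .
  qed
  from mvt_simple[of 0 1 "\<lambda>t. f (x + t *\<^sub>R (y - x))", OF zero_less_one this]
  obtain t where t: "t \<in> {0<..<1}" "f y - f x = inner (y - x) (G (x + t *\<^sub>R (y - x)))"
    by auto
  have "norm (t *\<^sub>R (y - x)) \<le> norm (y - x)"
    using t(1) by (simp add: mult_left_le_one_le)
  with t(2) show ?thesis
    by (intro exI[of _ "x + t *\<^sub>R (y - x)"]) (simp add: inner_commute)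
qed

text \<open>
  The bound on the gradient makes \<open>sqrt (1 + L)\<close> Lipschitz continuous, which is what allows
  \<open>1 + L\<close> to be compared at neighbouring points.
\<close>

locale lyapunov_function =
  fixes L :: "'v::euclidean_space \<Rightarrow> real" and G :: "'v \<Rightarrow> 'v" and C K :: real
  assumes nonneg: "0 \<le> L x"
    and gderiv: "GDERIV L x :> G x"
    and lipschitz: "norm (G y - G x) \<le> K * norm (y - x)"
    and growth: "(norm (G x))\<^sup>2 \<le> C * (1 + L x)"
begin

definition s :: "'v \<Rightarrow> real" where "s x = sqrt (1 + L x)"

definition grad_ln :: "'v \<Rightarrow> 'v" where "grad_ln x = (1 / (1 + L x)) *\<^sub>R G x"

lemma s_ge_1: "1 \<le> s x"
  using nonneg[of x] by (simp add: s_def)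

lemma s_pos: "0 < s x"
  using s_ge_1[of x] by linarith

lemma s_squared: "(s x)\<^sup>2 = 1 + L x"
  using nonneg[of x] by (simp add: s_def)

lemma C_nonneg: "0 \<le> C"
proof -
  have "0 \<le> C * (1 + L undefined)" using growth[of undefined] by (rule order.trans[rotated]) simp
  then show ?thesis using nonneg[of undefined] by (simp add: zero_le_mult_iff)
qed

lemma norm_G_le: "norm (G x) \<le> sqrt C * s x"
proof (rule power2_le_imp_le)
  show "(norm (G x))\<^sup>2 \<le> (sqrt C * s x)\<^sup>2"
    using growth[of x] C_nonneg by (simp add: power_mult_distrib s_squared)
qed (use C_nonneg s_pos[of x] in auto)

lemma norm_grad_ln_le: "norm (grad_ln x) \<le> sqrt C / s x"
proof -
  have "norm (grad_ln x) = norm (G x) / (s x)\<^sup>2"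
    using nonneg[of x] by (simp add: grad_ln_def s_squared)
  also have "\<dots> \<le> (sqrt C * s x) / (s x)\<^sup>2"
    using norm_G_le[of x] by (intro divide_right_mono) auto
  also have "\<dots> = sqrt C / s x" using s_pos[of x] by (simp add: power2_eq_square)
  finally show ?thesis .
qed

lemma norm_grad_ln_le_sqrt_C: "norm (grad_ln x) \<le> sqrt C"
proof -
  have "sqrt C / s x \<le> sqrt C"
    using s_ge_1[of x] C_nonneg by (simp add: divide_le_eq mult_left_mono[of 1 "s x" "sqrt C", simplified])
  then show ?thesis using norm_grad_ln_le[of x] by linarith
qed

lemma L_le_quadratic: "L y \<le> L x + inner (G x) (y - x) + K * (norm (y - x))\<^sup>2"
proof -
  obtain z where z: "norm (z - x) \<le> norm (y - x)" "L y - L x = inner (G z) (y - x)"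
    using GDERIV_mean_value[of L G, OF gderiv] by blast
  have K: "norm (G z - G x) \<le> K * norm (y - x)"
  proof (cases "z = x")
    case True
    then show ?thesis using order.trans[OF norm_ge_zero lipschitz[of y x]] by simp
  next
    case False
    have "0 \<le> K * norm (z - x)" using order.trans[OF norm_ge_zero lipschitz[of z x]] .
    then have "0 \<le> K" using False by (simp add: zero_le_mult_iff)
    then show ?thesis using lipschitz[of z x] mult_left_mono[OF z(1), of K] by linarith
  qed
  have "inner (G z - G x) (y - x) \<le> norm (G z - G x) * norm (y - x)"
    by (rule norm_cauchy_schwarz)
  also have "\<dots> \<le> K * norm (y - x) * norm (y - x)"
    using K by (intro mult_right_mono) auto
  finally show ?thesis using z(2) by (simp add: inner_diff_left power2_eq_square)
qed

lemma s_lipschitz: "\<bar>s y - s x\<bar> \<le> sqrt C * norm (y - x)"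
proof -
  have "GDERIV s x :> (1 / (2 * s x)) *\<^sub>R G x" for x
  proof -
    have "DERIV (\<lambda>t. sqrt (1 + t)) (L x) :> 1 / (2 * s x)"
      using nonneg[of x] unfolding s_def
      by (auto intro!: derivative_eq_intros simp: field_simps)
    from GDERIV_DERIV_compose[OF gderiv this] show ?thesis by (simp add: s_def[abs_def])
  qed
  from GDERIV_mean_value[of s, OF this] obtain z
    where "s y - s x = inner ((1 / (2 * s z)) *\<^sub>R G z) (y - x)" by blast
  then have "\<bar>s y - s x\<bar> \<le> norm ((1 / (2 * s z)) *\<^sub>R G z) * norm (y - x)"
    by (simp only: Cauchy_Schwarz_ineq2)
  also have "norm ((1 / (2 * s z)) *\<^sub>R G z) \<le> sqrt C"
  proof -
    have "norm (G z) \<le> 2 * (sqrt C * s z)"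
    proof -
      have "0 \<le> sqrt C * s z" using s_pos[of z] C_nonneg by simp
      then show ?thesis using norm_G_le[of z] by linarith
    qed
    then show ?thesis using s_pos[of z] by (simp add: field_simps)
  qed
  finally show ?thesis by (simp add: mult_right_mono)
qed

text \<open>
  Concavity of the logarithm turns the quadratic bound for \<open>L\<close> into one for \<open>ln (1 + L)\<close>, with the
  displacement measured in units of \<open>s x\<close>.
\<close>

lemma ln_le_quadratic:
  "ln (1 + L y) \<le> ln (1 + L x) + inner (grad_ln x) (y - x) + K * (norm (y - x) / s x)\<^sup>2"
proof -
  have pos: "0 < 1 + L x" "0 < 1 + L y" using nonneg[of x] nonneg[of y] by auto
  have "ln (1 + L y) - ln (1 + L x) = ln ((1 + L y) / (1 + L x))"
    using pos by (simp add: ln_div)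
  also have "\<dots> \<le> (1 + L y) / (1 + L x) - 1"
    using pos by (intro ln_le_minus_one) auto
  also have "\<dots> = (L y - L x) / (1 + L x)"
    using pos by (simp add: field_simps)
  also have "\<dots> \<le> (inner (G x) (y - x) + K * (norm (y - x))\<^sup>2) / (1 + L x)"
    using L_le_quadratic[of y x] pos by (intro divide_right_mono) auto
  also have "\<dots> = inner (grad_ln x) (y - x) + K * (norm (y - x) / s x)\<^sup>2"
    by (simp add: grad_ln_def power_divide s_squared add_divide_distrib)
  finally show ?thesis by simp
qed

text \<open>
  The right-hand side involves \<open>s\<close> only at the point \<open>x\<close> that is left. This asymmetry matters: the
  displacement of the recursion is controlled relative to \<open>s\<close> at its starting point.
\<close>

lemma grad_ln_step:
  "norm (grad_ln y - grad_ln x) \<le> (K + 2 * C) * (norm (y - x) / s x)"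
proof -
  let ?a = "s x" and ?b = "s y"
  have pos: "0 < ?a" "0 < ?b" "1 \<le> ?a" "1 \<le> ?b" using s_pos s_ge_1 by auto
  have "grad_ln y - grad_ln x
      = (1 / ?a\<^sup>2) *\<^sub>R (G y - G x) + (1 / ?b\<^sup>2 - 1 / ?a\<^sup>2) *\<^sub>R G y"
    by (simp add: grad_ln_def s_squared algebra_simps)
  also have "norm \<dots> \<le> K * (norm (y - x) / ?a) + 2 * C * (norm (y - x) / ?a)"
  proof (rule order.trans[OF norm_triangle_ineq], rule add_mono)
    \<comment> \<open>The change of the gradient, at a fixed denominator.\<close>
    have "?a \<le> ?a\<^sup>2" using pos by (simp add: power2_eq_square)
    then have "norm (G y - G x) / ?a\<^sup>2 \<le> norm (G y - G x) / ?a"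
      using pos by (intro divide_left_mono) auto
    also have "\<dots> \<le> K * norm (y - x) / ?a"
      using lipschitz[of y x] pos by (intro divide_right_mono) auto
    finally show "norm ((1 / ?a\<^sup>2) *\<^sub>R (G y - G x)) \<le> K * (norm (y - x) / ?a)"
      using pos by simp
    \<comment> \<open>The change of the denominator: one factor \<open>?b\<close> cancels against \<open>norm (G y) \<le> sqrt C * ?b\<close>.\<close>
    have "\<bar>1 / ?b\<^sup>2 - 1 / ?a\<^sup>2\<bar> = \<bar>?a - ?b\<bar> * (?a + ?b) / (?a\<^sup>2 * ?b\<^sup>2)"
    proof -
      have "1 / ?b\<^sup>2 - 1 / ?a\<^sup>2 = (?a - ?b) * (?a + ?b) / (?a\<^sup>2 * ?b\<^sup>2)"
        using pos by (simp add: field_simps power2_eq_square)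
      then show ?thesis using pos by (simp add: abs_mult)
    qed
    also have "\<dots> \<le> (sqrt C * norm (y - x)) * (?a + ?b) / (?a\<^sup>2 * ?b\<^sup>2)"
      using s_lipschitz[of y x] pos by (intro divide_right_mono mult_right_mono) (auto simp: abs_minus_commute)
    finally have "\<bar>1 / ?b\<^sup>2 - 1 / ?a\<^sup>2\<bar> * norm (G y)
        \<le> (sqrt C * norm (y - x)) * (?a + ?b) / (?a\<^sup>2 * ?b\<^sup>2) * (sqrt C * ?b)"
      using norm_G_le[of y] pos C_nonneg by (intro mult_mono) auto
    also have "\<dots> = C * norm (y - x) * ((?a + ?b) / (?a\<^sup>2 * ?b))"
    proof -
      have "sqrt C * sqrt C = C" using C_nonneg by simp
      then have "sqrt C * N * S / (?a\<^sup>2 * ?b\<^sup>2) * (sqrt C * ?b) = C * N * (S / (?a\<^sup>2 * ?b))" for N S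
        using pos by (simp add: power2_eq_square divide_simps)
      then show ?thesis .
    qed
    also have "\<dots> \<le> C * norm (y - x) * (2 / ?a)"
    proof (rule mult_left_mono)
      have "?a * 1 \<le> ?a * ?b" "1 * ?b \<le> ?a * ?b"
        using pos by (auto intro: mult_left_mono mult_right_mono simp del: mult_1_left mult_1_right)
      then have "?a + ?b \<le> 2 * (?a * ?b)" by linarith
      then have "(?a + ?b) / (?a\<^sup>2 * ?b) \<le> 2 * (?a * ?b) / (?a\<^sup>2 * ?b)"
        using pos by (intro divide_right_mono) auto
      also have "\<dots> = 2 / ?a"
        using pos by (simp add: power2_eq_square)
      finally show "(?a + ?b) / (?a\<^sup>2 * ?b) \<le> 2 / ?a" .
    qed (use C_nonneg in auto)
    finally show "norm ((1 / ?b\<^sup>2 - 1 / ?a\<^sup>2) *\<^sub>R G y) \<le> 2 * C * (norm (y - x) / ?a)"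
      by (simp only: norm_scaleR) (simp add: mult_ac)
  qed
  finally show ?thesis by (simp only: distrib_right)
qed

lemma inner_grad_ln_step:
  assumes h: "\<And>x. norm (h x) \<le> B" and h_lip: "norm (h y - h x) \<le> K' * norm (y - x)"
  shows "\<bar>inner (grad_ln y) (h y) - inner (grad_ln x) (h x)\<bar>
    \<le> ((K + 2 * C) * B + sqrt C * K') * (norm (y - x) / s x)"
proof -
  have "inner (grad_ln y) (h y) - inner (grad_ln x) (h x)
      = inner (grad_ln y - grad_ln x) (h y) + inner (grad_ln x) (h y - h x)"
    by (simp add: inner_diff_left inner_diff_right)
  also have "\<bar>\<dots>\<bar> \<le> (K + 2 * C) * (norm (y - x) / s x) * B + (sqrt C / s x) * (K' * norm (y - x))"
  proof (rule order.trans[OF abs_triangle_ineq], rule add_mono)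
    show "\<bar>inner (grad_ln y - grad_ln x) (h y)\<bar> \<le> (K + 2 * C) * (norm (y - x) / s x) * B"
      using grad_ln_step[of y x] h[of y]
      by (intro order.trans[OF Cauchy_Schwarz_ineq2] mult_mono) (auto intro: order.trans[OF norm_ge_zero])
    show "\<bar>inner (grad_ln x) (h y - h x)\<bar> \<le> (sqrt C / s x) * (K' * norm (y - x))"
      using norm_grad_ln_le[of x] h_lip s_pos[of x] C_nonneg
      by (intro order.trans[OF Cauchy_Schwarz_ineq2] mult_mono) auto
  qed
  also have "\<dots> = ((K + 2 * C) * B + sqrt C * K') * (norm (y - x) / s x)"
    by (simp add: ring_distribs add_divide_distrib mult_ac)
  finally show ?thesis .
qed

end

section \<open>Convergence along one trajectory\<close>

text \<open>
  A deterministic form of the Robbins-Siegmund lemma: minus the partial sums of \<open>d\<close>, the sequence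
  \<open>v\<close> is nonincreasing and bounded below. The perturbations \<open>d\<close> may have any sign, since only the
  convergence of their series enters.
\<close>

lemma convergent_and_summable_descent:
  fixes v a d :: "nat \<Rightarrow> real"
  assumes v: "\<And>n. 0 \<le> v n" and a: "\<And>n. 0 \<le> a n"
    and step: "\<And>n. v (Suc n) \<le> v n - a n + d n" and d: "summable d"
  shows "convergent v" "summable a"
proof -
  define e where "e n = v n - (\<Sum>k<n. d k)" for n
  have e_step: "e (Suc n) \<le> e n - a n" for n
    using step[of n] by (simp add: e_def)
  obtain R where R: "\<And>n. \<bar>\<Sum>k<n. d k\<bar> \<le> R"
    using convergent_imp_bounded[OF summable_LIMSEQ[OF d]] unfolding bounded_iff by auto
  have lower: "- R \<le> e n" for n
    using v[of n] R[of n] by (simp add: e_def abs_le_iff)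
  have "decseq e"
  proof (rule decseq_SucI)
    show "e (Suc n) \<le> e n" for n using e_step[of n] a[of n] by linarith
  qed
  then have "convergent e"
    using lower decseq_convergent[of e "- R"] by (metis convergentI)
  then have "convergent (\<lambda>n. e n + (\<Sum>k<n. d k))"
    using d by (intro convergent_add) (auto simp: summable_iff_convergent)
  then show "convergent v" by (simp add: e_def)
  have partial_sum: "(\<Sum>k<n. a k) \<le> e 0 - e n" for n
  proof (induction n)
    case (Suc n)
    then show ?case using e_step[of n] by simp
  qed simp
  have "(\<Sum>k<n. a k) \<le> e 0 + R" for n
    using partial_sum[of n] lower[of n] by linarith
  then show "summable a"
    using a by (intro summableI_nonneg_bounded[where x = "e 0 + R"]) auto
qed

lemma arbitrarily_small_if_summable_weighted:
  fixes \<gamma> k :: "nat \<Rightarrow> real"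
  assumes \<gamma>: "\<And>n. 0 \<le> \<gamma> n" and div: "\<not> summable \<gamma>" and sum: "summable (\<lambda>n. \<gamma> n * k n)"
    and e: "0 < e"
  shows "\<exists>n\<ge>N. k n < e"
proof (rule ccontr)
  assume "\<not> (\<exists>n\<ge>N. k n < e)"
  then have "\<And>n. n \<ge> N \<Longrightarrow> e \<le> k n" by force
  then have "norm (e * \<gamma> n) \<le> \<gamma> n * k n" if "n \<ge> N" for n
    using \<gamma>[of n] e that mult_left_mono[of e "k n" "\<gamma> n"] by (simp add: abs_mult mult.commute)
  then have "summable (\<lambda>n. e * \<gamma> n)"
    by (intro summable_comparison_test[OF _ sum]) blast
  then show False using div e by (simp add: summable_cmult_iff)
qed

locale mean_reverting_field = lyapunov_function L G C K
  for L :: "'v::euclidean_space \<Rightarrow> real" and G C K +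
  fixes h :: "'v \<Rightarrow> 'v" and \<theta>s :: 'v and B K' :: real
  assumes coercive: "filterlim L at_top at_infinity"
    and G_continuous: "continuous_on UNIV G"
    and h_bound: "norm (h x) \<le> B"
    and h_lipschitz: "norm (h y - h x) \<le> K' * norm (y - x)"
    and h_zero: "h \<theta>s = 0"
    and mean_reverting: "x \<noteq> \<theta>s \<Longrightarrow> inner (G x) (h x) > 0"
begin

definition descent :: "'v \<Rightarrow> real" where "descent x = inner (grad_ln x) (h x)"

lemma L_continuous: "continuous_on A L"
  using gderiv unfolding gderiv_def
  by (meson continuous_at_imp_continuous_on has_derivative_continuous)

lemma h_continuous: "continuous_on A h"
proof -
  have "0 \<le> \<bar>K'\<bar>" by simp
  moreover have "norm (h y - h x) \<le> \<bar>K'\<bar> * norm (y - x)" for x y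
    by (rule order.trans[OF h_lipschitz]) (simp add: mult_right_mono)
  ultimately have "\<bar>K'\<bar>-lipschitz_on A h"
    by (intro lipschitz_onI) (auto simp: dist_norm)
  then show ?thesis by (rule lipschitz_on_continuous_on)
qed

lemma descent_nonneg: "0 \<le> descent x"
proof (cases "x = \<theta>s")
  case True
  then show ?thesis by (simp add: descent_def h_zero)
next
  case False
  then show ?thesis using mean_reverting[of x] nonneg[of x]
    by (simp add: descent_def grad_ln_def)
qed

lemma descent_pos: "x \<noteq> \<theta>s \<Longrightarrow> 0 < descent x"
  using mean_reverting[of x] nonneg[of x] by (simp add: descent_def grad_ln_def)

lemma descent_continuous: "continuous_on A descent"
  unfolding descent_def[abs_def] grad_ln_def
proof (intro continuous_intros L_continuous h_continuous)
  show "continuous_on A G" using G_continuous continuous_on_subset by blast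
  show "\<forall>x\<in>A. 1 + L x \<noteq> 0" using nonneg by (metis add_nonneg_eq_0_iff zero_le_one zero_neq_one)
qed

lemma bounded_sublevel: "bounded {x. L x \<le> c}"
proof -
  have "eventually (\<lambda>x. c < L x) at_infinity"
    using coercive by (simp add: filterlim_at_top_dense)
  then obtain b where b: "\<And>x. norm x \<ge> b \<Longrightarrow> c < L x"
    by (auto simp: eventually_at_infinity)
  then show ?thesis
    unfolding bounded_iff by (metis linorder_not_le mem_Collect_eq linorder_le_cases)
qed

lemma minimum_eq_theta_star:
  assumes "\<And>y. L m \<le> L y"
  shows "m = \<theta>s"
proof -
  have "(\<lambda>v. inner v (G m)) = (\<lambda>v. 0)"
    using gderiv[of m] assms unfolding gderiv_def
    by (intro differential_zero_maxmin[of m UNIV L]) auto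
  then have "inner (h m) (G m) = 0" by metis
  then show ?thesis using mean_reverting[of m] by (auto simp: inner_commute)
qed

text \<open>
  A coercive continuous function attains its minimum, and there its gradient vanishes; mean reversion
  leaves \<open>\<theta>s\<close> as the only point at which this can happen.
\<close>

lemma L_eq_minimum_imp_eq:
  assumes "L x = L \<theta>s"
  shows "x = \<theta>s"
proof -
  let ?S = "{x. L x \<le> L \<theta>s}"
  have "closed ?S"
    by (rule closed_Collect_le) (auto intro: L_continuous)
  then have "compact ?S" using bounded_sublevel by (simp add: compact_eq_bounded_closed)
  then obtain m where m: "m \<in> ?S" "\<forall>y\<in>?S. L m \<le> L y"
    using continuous_attains_inf[of ?S L] L_continuous by auto
  then have min: "L m \<le> L y" for y
    by (cases "y \<in> ?S") auto
  then have "m = \<theta>s" by (rule minimum_eq_theta_star)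
  then show ?thesis using min assms by (intro minimum_eq_theta_star) simp
qed

text \<open>
  Coercivity confines \<open>\<theta>\<close> to a compact sublevel set, and \<open>L\<close> takes the same value at all cluster
  points. Small values of \<open>descent\<close> at arbitrarily late times make \<open>\<theta>s\<close> one of them,
  and \<open>\<theta>s\<close> is the only point at its level.
\<close>

lemma tendsto_if_L_convergent:
  assumes conv: "convergent (\<lambda>n. L (\<theta> n))"
    and small: "\<And>e N. 0 < e \<Longrightarrow> \<exists>n\<ge>N. descent (\<theta> n) < e"
  shows "\<theta> \<longlonglongrightarrow> \<theta>s"
proof -
  obtain l where l: "(\<lambda>n. L (\<theta> n)) \<longlonglongrightarrow> l" using conv by (auto simp: convergent_def)
  obtain c where c: "\<And>n. L (\<theta> n) \<le> c"
    using convergent_imp_bounded[OF l] unfolding bounded_iff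
    by (metis UNIV_I abs_le_D1 image_eqI real_norm_def)
  have bdd: "bounded (range (\<theta> \<circ> r))" for r :: "nat \<Rightarrow> nat"
    using c by (intro bounded_subset[OF bounded_sublevel[of c]]) auto
  have cluster: "L x = l" if "filterlim r at_top sequentially" "(\<theta> \<circ> r) \<longlonglongrightarrow> x" for r x
  proof -
    have "(\<lambda>n. L ((\<theta> \<circ> r) n)) \<longlonglongrightarrow> L x"
      by (rule continuous_on_tendsto_compose[OF L_continuous[of UNIV] that(2)]) auto
    moreover have "(\<lambda>n. L ((\<theta> \<circ> r) n)) \<longlonglongrightarrow> l"
      using filterlim_compose[OF l that(1)] by (simp add: o_def)
    ultimately show ?thesis by (rule LIMSEQ_unique)
  qed
  have "l = L \<theta>s"
  proof -
    \<comment> \<open>A subsequence along which \<open>descent\<close> tends to 0 clusters at a zero of \<open>descent\<close>, that is, at \<open>\<theta>s\<close>.\<close>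
    have "\<forall>j. \<exists>n\<ge>j. descent (\<theta> n) < 1 / real (Suc j)"
      using small by simp
    then obtain r where r: "\<And>j. j \<le> r j" "\<And>j. descent (\<theta> (r j)) < 1 / real (Suc j)"
      by metis
    obtain x r2 where r2: "strict_mono r2" "(\<theta> \<circ> r \<circ> r2) \<longlonglongrightarrow> x"
      using bounded_imp_convergent_subsequence[OF bdd] by metis
    let ?r = "r \<circ> r2"
    have "n \<le> ?r n" for n
      using r(1)[of "r2 n"] seq_suble[OF r2(1), of n] by simp
    then have to_top: "filterlim ?r at_top sequentially"
      by (intro filterlim_at_top_mono[OF filterlim_ident]) auto
    have lim: "(\<theta> \<circ> ?r) \<longlonglongrightarrow> x" using r2(2) by (simp add: o_assoc)
    have "(\<lambda>n. descent ((\<theta> \<circ> ?r) n)) \<longlonglongrightarrow> descent x"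
      by (rule continuous_on_tendsto_compose[OF descent_continuous[of UNIV] lim]) auto
    moreover have "(\<lambda>n. descent ((\<theta> \<circ> ?r) n)) \<longlonglongrightarrow> 0"
    proof (rule Lim_null_comparison)
      have "(\<lambda>n. 1 / real (Suc n)) \<longlonglongrightarrow> 0" by (rule lim_1_over_n[THEN LIMSEQ_Suc])
      from LIMSEQ_subseq_LIMSEQ[OF this r2(1)]
      show "(\<lambda>n. 1 / real (Suc (r2 n))) \<longlonglongrightarrow> 0" by (simp add: o_def)
      show "\<forall>\<^sub>F n in sequentially. norm (descent ((\<theta> \<circ> ?r) n)) \<le> 1 / real (Suc (r2 n))"
        using r descent_nonneg by (auto intro!: always_eventually less_imp_le)
    qed
    ultimately have "descent x = 0" by (rule LIMSEQ_unique)
    then have "x = \<theta>s" using descent_pos[of x] by force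
    then show ?thesis using cluster[OF to_top lim] by simp
  qed
  show ?thesis
  proof (rule ccontr)
    assume "\<not> \<theta> \<longlonglongrightarrow> \<theta>s"
    then obtain e where e: "0 < e" "\<not> (\<forall>\<^sub>F n in sequentially. dist (\<theta> n) \<theta>s < e)"
      by (auto simp: tendsto_iff)
    then have "\<forall>N. \<exists>n\<ge>N. e \<le> dist (\<theta> n) \<theta>s"
      by (auto simp: eventually_sequentially not_less)
    then have "infinite {n. e \<le> dist (\<theta> n) \<theta>s}"
      unfolding infinite_nat_iff_unbounded_le by simp
    then obtain r :: "nat \<Rightarrow> nat" where r: "strict_mono r" "\<And>n. r n \<in> {n. e \<le> dist (\<theta> n) \<theta>s}"
      using infinite_enumerate by blast
    obtain x r2 where r2: "strict_mono r2" "(\<theta> \<circ> r \<circ> r2) \<longlonglongrightarrow> x"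
      using bounded_imp_convergent_subsequence[OF bdd] by metis
    have "x = \<theta>s"
      using cluster[OF filterlim_subseq[OF strict_mono_o[OF r(1) r2(1)]]] r2(2) \<open>l = L \<theta>s\<close> L_eq_minimum_imp_eq
      by (simp add: o_assoc)
    moreover have "e \<le> dist x \<theta>s"
      using r by (intro tendsto_lowerbound[OF tendsto_dist[OF r2(2) tendsto_const]]) auto
    ultimately show False using e(1) by simp
  qed
qed

text \<open>
  The probabilistic input is reduced here to properties of a single trajectory: the growth of the
  partial sums of \<open>c - 1\<close> and of \<open>\<eta>\<close>, the convergence of the martingale series, and two series in
  \<open>\<zeta>\<close>, which measures the displacement relative to \<open>s\<close>.
\<close>

lemma trajectory_tendsto:
  fixes \<theta> m \<eta> :: "nat \<Rightarrow> 'v" and c \<gamma> w \<zeta> :: "nat \<Rightarrow> real"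
  assumes recursion: "\<And>n. \<theta> (Suc n) = \<theta> n - \<gamma> (Suc n) *\<^sub>R (c n *\<^sub>R h (\<theta> n) + \<eta> n + m n)"
    and step: "\<And>n. norm (\<theta> (Suc n) - \<theta> n) / s (\<theta> n) \<le> \<gamma> (Suc n) * \<zeta> n"
    and \<gamma>_nonneg: "\<And>n. n \<ge> 1 \<Longrightarrow> 0 \<le> \<gamma> n"
    and \<gamma>_decreasing: "\<And>n. n \<ge> 1 \<Longrightarrow> \<gamma> (Suc n) \<le> \<gamma> n"
    and \<gamma>_div: "\<not> summable (\<lambda>n. \<gamma> (Suc n))"
    and \<gamma>_lim: "(\<lambda>n. w n * \<gamma> n) \<longlonglongrightarrow> 0"
    and \<gamma>_var: "summable (\<lambda>n. w (Suc n) * \<bar>\<gamma> (Suc (Suc n)) - \<gamma> (Suc n)\<bar>)"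
    and c: "\<exists>A. \<forall>\<^sub>F n in sequentially. \<bar>\<Sum>k<n. c k - 1\<bar> \<le> A * w n"
    and \<eta>: "\<And>b. b \<in> Basis \<Longrightarrow> \<exists>A. \<forall>\<^sub>F n in sequentially. \<bar>\<Sum>k<n. inner (\<eta> k) b\<bar> \<le> A * w n"
    and m: "summable (\<lambda>n. \<gamma> (Suc n) * inner (grad_ln (\<theta> n)) (m n))"
    and \<zeta>_w: "summable (\<lambda>n. w (Suc n) * (\<gamma> (Suc n))\<^sup>2 * \<zeta> n)"
    and \<zeta>_sq: "summable (\<lambda>n. (\<gamma> (Suc n) * \<zeta> n)\<^sup>2)"
  shows "\<theta> \<longlonglongrightarrow> \<theta>s"
proof -
  let ?u = "\<lambda>n. grad_ln (\<theta> n)" and ?\<gamma> = "\<lambda>n. \<gamma> (Suc n)" and ?k = "\<lambda>n. descent (\<theta> n)"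
  have B: "0 \<le> B" and CK: "0 \<le> K + 2 * C" and K: "0 \<le> K" and K': "0 \<le> K'"
  proof -
    show "0 \<le> B" using h_bound[of undefined] norm_ge_zero order.trans by blast
    obtain x :: 'v where "norm x = 1" using vector_choose_size[of 1] by auto
    then show "0 \<le> K" "0 \<le> K'"
      using order.trans[OF norm_ge_zero lipschitz[of x 0]] order.trans[OF norm_ge_zero h_lipschitz[of x 0]] by auto
    then show "0 \<le> K + 2 * C" using C_nonneg by simp
  qed
  \<comment> \<open>Both averaging terms have the form to which summation by parts applies, with weights that
    change by at most a constant times the displacement relative to \<open>s\<close>.\<close>
  have averaged: "summable (\<lambda>n. ?\<gamma> n * u n * b n)"
    if b: "\<exists>A. \<forall>\<^sub>F n in sequentially. \<bar>\<Sum>k<n. b k\<bar> \<le> A * w n"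
      and u: "\<And>n. \<bar>u n\<bar> \<le> U"
      and u_step: "\<And>n. \<bar>u (Suc n) - u n\<bar> \<le> R * (norm (\<theta> (Suc n) - \<theta> n) / s (\<theta> n))" and R: "0 \<le> R"
    for b u :: "nat \<Rightarrow> real" and U R
  proof -
    obtain A where A: "\<forall>\<^sub>F n in sequentially. \<bar>\<Sum>k<n. b k\<bar> \<le> A * w n" using b by blast
    have "\<bar>u (Suc n) - u n\<bar> \<le> ?\<gamma> n * (R * \<zeta> n)" for n
      using order.trans[OF u_step mult_left_mono[OF step R]] by (simp add: mult_ac)
    moreover have "summable (\<lambda>n. w (Suc n) * (?\<gamma> n)\<^sup>2 * (R * \<zeta> n))"
      using summable_mult[OF \<zeta>_w, of R] by (simp add: mult_ac)
    ultimately show ?thesis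
      by (intro summable_eventually_bounded_partial_sums[OF A u _ \<gamma>_nonneg \<gamma>_decreasing \<gamma>_lim \<gamma>_var])
  qed
  have c_sum: "summable (\<lambda>n. ?\<gamma> n * ?k n * (c n - 1))"
  proof (rule averaged[OF c])
    show "\<bar>?k n\<bar> \<le> sqrt C * B" for n
      unfolding descent_def using norm_grad_ln_le_sqrt_C h_bound C_nonneg
      by (intro order.trans[OF Cauchy_Schwarz_ineq2] mult_mono) auto
    show "\<bar>?k (Suc n) - ?k n\<bar> \<le> ((K + 2 * C) * B + sqrt C * K') * (norm (\<theta> (Suc n) - \<theta> n) / s (\<theta> n))" for n
      unfolding descent_def by (rule inner_grad_ln_step) (rule h_bound h_lipschitz)+
    show "0 \<le> (K + 2 * C) * B + sqrt C * K'" using B CK K' C_nonneg by simp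
  qed
  have "summable (\<lambda>n. ?\<gamma> n * inner (?u n) b * inner (\<eta> n) b)" if b: "b \<in> Basis" for b
  proof (rule averaged[OF \<eta>[OF b] _ _ CK])
    show "\<bar>inner (?u n) b\<bar> \<le> sqrt C" for n
      using Basis_le_norm[OF b, of "?u n"] norm_grad_ln_le_sqrt_C[of "\<theta> n"] by linarith
    show "\<bar>inner (?u (Suc n)) b - inner (?u n) b\<bar> \<le> (K + 2 * C) * (norm (\<theta> (Suc n) - \<theta> n) / s (\<theta> n))" for n
      using Basis_le_norm[OF b, of "?u (Suc n) - ?u n"] grad_ln_step[of "\<theta> (Suc n)" "\<theta> n"]
      by (simp add: inner_diff_left)
  qed
  then have "summable (\<lambda>n. \<Sum>b\<in>Basis. ?\<gamma> n * inner (?u n) b * inner (\<eta> n) b)"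
    by (rule summable_sum)
  then have \<eta>_sum: "summable (\<lambda>n. ?\<gamma> n * inner (?u n) (\<eta> n))"
    by (simp add: euclidean_inner[of "?u _" "\<eta> _"] sum_distrib_left mult.assoc)
  define d where "d n = - (?\<gamma> n * ?k n * (c n - 1)) - ?\<gamma> n * inner (?u n) (\<eta> n)
      - ?\<gamma> n * inner (?u n) (m n) + K * (?\<gamma> n * \<zeta> n)\<^sup>2" for n
  have d: "summable d"
    unfolding d_def[abs_def]
    by (intro summable_add summable_diff summable_minus summable_mult c_sum \<eta>_sum m \<zeta>_sq)
  have descent_step: "ln (1 + L (\<theta> (Suc n))) \<le> ln (1 + L (\<theta> n)) - ?\<gamma> n * ?k n + d n" for n
  proof -
    have "(norm (\<theta> (Suc n) - \<theta> n) / s (\<theta> n))\<^sup>2 \<le> (?\<gamma> n * \<zeta> n)\<^sup>2"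
      using step[of n] s_pos[of "\<theta> n"] by (intro power_mono) auto
    then have "K * (norm (\<theta> (Suc n) - \<theta> n) / s (\<theta> n))\<^sup>2 \<le> K * (?\<gamma> n * \<zeta> n)\<^sup>2"
      using K by (rule mult_left_mono)
    moreover have "inner (?u n) (\<theta> (Suc n) - \<theta> n) =
        - (?\<gamma> n * ?k n) - ?\<gamma> n * ?k n * (c n - 1) - ?\<gamma> n * inner (?u n) (\<eta> n) - ?\<gamma> n * inner (?u n) (m n)"
      by (simp add: recursion descent_def inner_add_right algebra_simps)
    ultimately show ?thesis
      using ln_le_quadratic[of "\<theta> (Suc n)" "\<theta> n"] by (simp add: d_def)
  qed
  have ln_nonneg: "0 \<le> ln (1 + L (\<theta> n))" for n using nonneg[of "\<theta> n"] by simp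
  have k_nonneg: "0 \<le> ?\<gamma> n * ?k n" for n
    using \<gamma>_nonneg[of "Suc n"] descent_nonneg[of "\<theta> n"] by simp
  note descent_limits = convergent_and_summable_descent[OF ln_nonneg k_nonneg descent_step d]
  obtain l where "(\<lambda>n. ln (1 + L (\<theta> n))) \<longlonglongrightarrow> l"
    using descent_limits(1) by (auto simp: convergent_def)
  then have "(\<lambda>n. exp (ln (1 + L (\<theta> n))) - 1) \<longlonglongrightarrow> exp l - 1"
    by (intro tendsto_intros)
  moreover have "exp (ln (1 + L x)) - 1 = L x" for x
    using nonneg[of x] by (subst exp_ln) auto
  ultimately have "convergent (\<lambda>n. L (\<theta> n))" by (auto simp: convergent_def)
  moreover have "\<exists>n\<ge>N. ?k n < e" if "0 < e" for e N
    using \<gamma>_nonneg by (intro arbitrarily_small_if_summable_weighted[OF _ \<gamma>_div descent_limits(2) that]) auto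
  ultimately show ?thesis by (rule tendsto_if_L_convergent)
qed

end

section \<open>Square-integrable martingale differences\<close>

lemma (in finite_measure) integrable_mult_if_squares:
  fixes f g :: "'a \<Rightarrow> real"
  assumes [measurable]: "f \<in> borel_measurable M" "g \<in> borel_measurable M"
    and "integrable M (\<lambda>x. (f x)\<^sup>2)" "integrable M (\<lambda>x. (g x)\<^sup>2)"
  shows "integrable M (\<lambda>x. f x * g x)"
proof (rule Bochner_Integration.integrable_bound)
  show "integrable M (\<lambda>x. (f x)\<^sup>2 + (g x)\<^sup>2)" using assms by simp
  show "AE x in M. norm (f x * g x) \<le> norm ((f x)\<^sup>2 + (g x)\<^sup>2)"
  proof (rule AE_I2)
    fix x
    have "2 * (\<bar>f x\<bar> * \<bar>g x\<bar>) \<le> (f x)\<^sup>2 + (g x)\<^sup>2"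
      using sum_squares_bound[of "\<bar>f x\<bar>" "\<bar>g x\<bar>"] by simp
    moreover have "0 \<le> \<bar>f x\<bar> * \<bar>g x\<bar>" by simp
    ultimately have "\<bar>f x\<bar> * \<bar>g x\<bar> \<le> (f x)\<^sup>2 + (g x)\<^sup>2" by linarith
    then show "norm (f x * g x) \<le> norm ((f x)\<^sup>2 + (g x)\<^sup>2)"
      by (simp add: abs_mult)
  qed
qed simp

text \<open>
  Square integrability makes each difference orthogonal to every square-integrable function of the
  past; the convergence theorem rests on this orthogonality.
\<close>

locale martingale_differences = prob_space M
  for M :: "'a measure" +
  fixes F :: "nat \<Rightarrow> 'a measure" and D :: "nat \<Rightarrow> 'a \<Rightarrow> real"
  assumes subalg: "subalgebra M (F n)"
    and F_mono: "i \<le> j \<Longrightarrow> sets (F i) \<subseteq> sets (F j)"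
    and D_adapted: "D n \<in> borel_measurable (F (Suc n))"
    and D_square: "integrable M (\<lambda>\<omega>. (D n \<omega>)\<^sup>2)"
    and D_increment: "AE \<omega> in M. real_cond_exp M (F n) (D n) \<omega> = 0"
begin

lemma space_F: "space (F n) = space M"
  using subalg by (simp add: subalgebra_def)

lemma measurable_F_mono: "f \<in> borel_measurable (F i) \<Longrightarrow> i \<le> j \<Longrightarrow> f \<in> borel_measurable (F j)"
  using F_mono[of i j] space_F by (auto simp: measurable_def)

lemma measurable_F_M: "f \<in> borel_measurable (F i) \<Longrightarrow> f \<in> borel_measurable M"
  using subalg by (rule measurable_from_subalg)

lemma D_measurable [measurable]: "D n \<in> borel_measurable M"
  using D_adapted by (rule measurable_F_M)

lemma partial_sum_adapted: "n \<le> m \<Longrightarrow> (\<lambda>\<omega>. \<Sum>k<n. D k \<omega>) \<in> borel_measurable (F m)"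
  by (intro borel_measurable_sum measurable_F_mono[OF D_adapted]) auto

lemma orthogonal:
  assumes Z: "Z \<in> borel_measurable (F n)" "integrable M (\<lambda>\<omega>. (Z \<omega>)\<^sup>2)"
  shows "(\<integral>\<omega>. Z \<omega> * D n \<omega> \<partial>M) = 0"
proof -
  interpret S: finite_measure_subalgebra M "F n"
    by standard (rule subalg)
  have "integrable M (\<lambda>\<omega>. Z \<omega> * D n \<omega>)"
    using Z D_square measurable_F_M[OF Z(1)] by (intro integrable_mult_if_squares) auto
  then have "(\<integral>\<omega>. Z \<omega> * D n \<omega> \<partial>M) = (\<integral>\<omega>. Z \<omega> * real_cond_exp M (F n) (D n) \<omega> \<partial>M)"
    using Z(1) by (intro S.real_cond_exp_intg(2)[symmetric]) auto
  also have "\<dots> = (\<integral>\<omega>. 0 \<partial>M)"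
    using D_increment[of n] measurable_F_M[OF Z(1)]
    by (intro integral_cong_AE) auto
  finally show ?thesis by simp
qed

text \<open>
  Stopping at a time determined by the past multiplies \<open>D n\<close> by an indicator that is measurable with
  respect to \<open>F n\<close>; the result is again a sequence of martingale differences.
\<close>

lemma stopped:
  assumes A: "\<And>n. Measurable.pred (F n) (A n)"
  shows "martingale_differences M F (\<lambda>n \<omega>. of_bool (A n \<omega>) * D n \<omega>)"
proof
  fix n
  have ind: "(\<lambda>\<omega>. of_bool (A n \<omega>) :: real) \<in> borel_measurable (F n)"
    using A[of n] by measurable
  show "(\<lambda>\<omega>. of_bool (A n \<omega>) * D n \<omega>) \<in> borel_measurable (F (Suc n))"
    using measurable_F_mono[OF ind, of "Suc n"] D_adapted[of n] by simp
  have [measurable]: "(\<lambda>\<omega>. of_bool (A n \<omega>) :: real) \<in> borel_measurable M"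
    using ind by (rule measurable_F_M)
  show "integrable M (\<lambda>\<omega>. (of_bool (A n \<omega>) * D n \<omega>)\<^sup>2)"
    by (rule Bochner_Integration.integrable_bound[OF D_square[of n]])
      (auto simp: power_mult_distrib)
  interpret S: finite_measure_subalgebra M "F n"
    by standard (rule subalg)
  have "integrable M (\<lambda>\<omega>. of_bool (A n \<omega>) * D n \<omega>)"
  proof (rule integrable_mult_if_squares)
    show "integrable M (\<lambda>\<omega>. (of_bool (A n \<omega>) :: real)\<^sup>2)"
      by (rule integrable_const_bound[of _ 1]) auto
  qed (simp_all add: D_square)
  from S.real_cond_exp_mult[OF ind D_measurable this] D_increment[of n]
  show "AE \<omega> in M. real_cond_exp M (F n) (\<lambda>\<omega>. of_bool (A n \<omega>) * D n \<omega>) \<omega> = 0"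
    by eventually_elim simp
qed (use subalg F_mono in auto)

lemma shifted: "martingale_differences M (\<lambda>n. F (m + n)) (\<lambda>n. D (m + n))"
  by standard (use subalg F_mono D_square D_increment D_adapted[of "m + _"] in auto)

lemma partial_sum_square:
  "integrable M (\<lambda>\<omega>. (\<Sum>k<n. D k \<omega>)\<^sup>2) \<and>
    (\<integral>\<omega>. (\<Sum>k<n. D k \<omega>)\<^sup>2 \<partial>M) = (\<Sum>k<n. \<integral>\<omega>. (D k \<omega>)\<^sup>2 \<partial>M)"
proof (induction n)
  case (Suc n)
  let ?S = "\<lambda>\<omega>. \<Sum>k<n. D k \<omega>"
  have S: "?S \<in> borel_measurable (F n)" by (rule partial_sum_adapted) simp
  have int: "integrable M (\<lambda>\<omega>. ?S \<omega> * D n \<omega>)"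
    using Suc D_square measurable_F_M[OF S] by (intro integrable_mult_if_squares) auto
  have "(\<Sum>k<Suc n. D k \<omega>)\<^sup>2 = (?S \<omega>)\<^sup>2 + (D n \<omega>)\<^sup>2 + 2 * (?S \<omega> * D n \<omega>)" for \<omega>
    by (simp add: power2_sum)
  then show ?case
    using Suc int D_square[of n] orthogonal[OF S] by simp
qed simp

text \<open>
  Stop the partial sums at their first exit from \<open>]-a, a[\<close>. On the event in question the stopped sum
  at time \<open>N\<close> has absolute value at least \<open>a\<close>, while orthogonality bounds its second moment;
  Markov's inequality does the rest.
\<close>

lemma maximal_inequality:
  assumes a: "0 < a"
  shows "prob {\<omega>\<in>space M. \<exists>n\<le>N. a \<le> \<bar>\<Sum>k<n. D k \<omega>\<bar>} \<le> (\<Sum>k<N. \<integral>\<omega>. (D k \<omega>)\<^sup>2 \<partial>M) / a\<^sup>2"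
proof -
  let ?S = "\<lambda>n \<omega>. \<Sum>k<n. D k \<omega>"
  let ?A = "\<lambda>n \<omega>. \<forall>j\<le>n. \<bar>?S j \<omega>\<bar> < a"
  have "Measurable.pred (F n) (?A n)" for n
  proof -
    have [measurable]: "?S j \<in> borel_measurable (F n)" if "j \<in> {..n}" for j
      using that by (intro partial_sum_adapted) auto
    have "Measurable.pred (F n) (\<lambda>\<omega>. \<forall>j\<in>{..n}. \<bar>?S j \<omega>\<bar> < a)"
      by measurable
    then show ?thesis by (simp add: Ball_def)
  qed
  then interpret T: martingale_differences M F "\<lambda>n \<omega>. of_bool (?A n \<omega>) * D n \<omega>"
    by (rule stopped)
  let ?T = "\<lambda>n \<omega>. \<Sum>k<n. of_bool (?A k \<omega>) * D k \<omega>"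
  \<comment> \<open>Before the exit the stopped sum is the original one; from the exit on it keeps its value,
    which is at least \<open>a\<close> in absolute value. The index \<open>Suc n\<close> occurs because \<open>?A n\<close> decides
    whether \<open>D n\<close> is still added.\<close>
  have frozen: "?A n \<omega> \<and> ?T (Suc n) \<omega> = ?S (Suc n) \<omega> \<or> \<not> ?A n \<omega> \<and> a \<le> \<bar>?T (Suc n) \<omega>\<bar>" for n \<omega>
  proof (induction n)
    case (Suc n)
    then show ?case
    proof (elim disjE conjE)
      assume *: "?A n \<omega>" "?T (Suc n) \<omega> = ?S (Suc n) \<omega>"
      show ?case
      proof (cases "\<bar>?S (Suc n) \<omega>\<bar> < a")
        case True
        with *(1) have "?A (Suc n) \<omega>" by (auto simp: le_Suc_eq)
        with *(2) show ?thesis by simp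
      next
        case False
        then have "\<not> ?A (Suc n) \<omega>" by blast
        with *(2) False show ?thesis by simp
      qed
    next
      assume *: "\<not> ?A n \<omega>" "a \<le> \<bar>?T (Suc n) \<omega>\<bar>"
      have stop: "\<not> ?A (Suc n) \<omega>" using *(1) le_SucI by blast
      have "?T (Suc (Suc n)) \<omega> = ?T (Suc n) \<omega>"
        by (subst sum.lessThan_Suc) (simp only: stop of_bool_eq mult_zero_left add_0_right)
      then have "a \<le> \<bar>?T (Suc (Suc n)) \<omega>\<bar>" using *(2) by (simp only:)
      with stop show ?case by blast
    qed
  qed (use a in simp)
  have large: "a\<^sup>2 \<le> (?T N \<omega>)\<^sup>2" if "\<exists>n\<le>N. a \<le> \<bar>?S n \<omega>\<bar>" for \<omega>
  proof -
    have "N \<noteq> 0" using that a by (intro notI) auto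
    then obtain N' where N': "N = Suc N'" using not0_implies_Suc by blast
    have "a \<le> \<bar>?T N \<omega>\<bar>"
      using frozen[of N' \<omega>] that N' by (auto simp: le_Suc_eq not_less simp del: sum.lessThan_Suc)
    then show ?thesis using a by (simp add: abs_le_square_iff[symmetric])
  qed
  have int: "integrable M (\<lambda>\<omega>. (?T N \<omega>)\<^sup>2)"
    and eq: "(\<integral>\<omega>. (?T N \<omega>)\<^sup>2 \<partial>M) = (\<Sum>k<N. \<integral>\<omega>. (of_bool (?A k \<omega>) * D k \<omega>)\<^sup>2 \<partial>M)"
    using T.partial_sum_square[of N] by auto
  have "prob {\<omega>\<in>space M. \<exists>n\<le>N. a \<le> \<bar>?S n \<omega>\<bar>} \<le> prob {\<omega>\<in>space M. a\<^sup>2 \<le> (?T N \<omega>)\<^sup>2}"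
    using large int by (intro finite_measure_mono) auto
  also have "\<dots> \<le> (\<integral>\<omega>. (?T N \<omega>)\<^sup>2 \<partial>M) / a\<^sup>2"
    using a int by (intro integral_Markov_inequality_measure[where A = "{}"]) auto
  also have "\<dots> \<le> (\<Sum>k<N. \<integral>\<omega>. (D k \<omega>)\<^sup>2 \<partial>M) / a\<^sup>2"
    unfolding eq using T.D_square D_square
    by (intro divide_right_mono sum_mono integral_mono) (auto simp: power_mult_distrib)
  finally show ?thesis .
qed

lemma maximal_inequality_infinite:
  assumes a: "0 < a" and sum: "summable (\<lambda>k. \<integral>\<omega>. (D k \<omega>)\<^sup>2 \<partial>M)"
  shows "prob {\<omega>\<in>space M. \<exists>n. a \<le> \<bar>\<Sum>k<n. D k \<omega>\<bar>} \<le> (\<Sum>k. \<integral>\<omega>. (D k \<omega>)\<^sup>2 \<partial>M) / a\<^sup>2"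
proof -
  let ?E = "\<lambda>N. {\<omega>\<in>space M. \<exists>n\<le>N. a \<le> \<bar>\<Sum>k<n. D k \<omega>\<bar>}"
  have "?E N \<in> events" for N by measurable
  moreover have "incseq ?E" by (auto simp: incseq_def intro: order.trans)
  ultimately have "(\<lambda>N. prob (?E N)) \<longlonglongrightarrow> prob (\<Union>N. ?E N)"
    by (intro finite_Lim_measure_incseq) auto
  moreover have "prob (?E N) \<le> (\<Sum>k. \<integral>\<omega>. (D k \<omega>)\<^sup>2 \<partial>M) / a\<^sup>2" for N
    using sum by (intro order.trans[OF maximal_inequality[OF a]] divide_right_mono sum_le_suminf) auto
  ultimately have "prob (\<Union>N. ?E N) \<le> (\<Sum>k. \<integral>\<omega>. (D k \<omega>)\<^sup>2 \<partial>M) / a\<^sup>2"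
    by (intro LIMSEQ_le_const2) auto
  moreover have "(\<Union>N. ?E N) = {\<omega>\<in>space M. \<exists>n. a \<le> \<bar>\<Sum>k<n. D k \<omega>\<bar>}" by auto
  ultimately show ?thesis by simp
qed

text \<open>
  The maximal inequality for the sequence started at \<open>m\<close> bounds the probability that the partial sums
  still oscillate by \<open>a\<close> after \<open>m\<close>, and the bound is the tail of a convergent series; so almost surely
  the partial sums form a Cauchy sequence.
\<close>

lemma AE_summable:
  assumes sum: "summable (\<lambda>k. \<integral>\<omega>. (D k \<omega>)\<^sup>2 \<partial>M)"
  shows "AE \<omega> in M. summable (\<lambda>k. D k \<omega>)"
proof -
  let ?S = "\<lambda>m n \<omega>. \<Sum>k<n. D (m + k) \<omega>"
  let ?v = "\<lambda>k. \<integral>\<omega>. (D k \<omega>)\<^sup>2 \<partial>M"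
  have small: "AE \<omega> in M. \<exists>m. \<forall>n. \<bar>?S m n \<omega>\<bar> < a" if a: "0 < a" for a
  proof -
    let ?E = "\<lambda>m. {\<omega>\<in>space M. \<exists>n. a \<le> \<bar>?S m n \<omega>\<bar>}"
    let ?N = "{\<omega>\<in>space M. \<forall>m. \<exists>n. a \<le> \<bar>?S m n \<omega>\<bar>}"
    have N: "?N \<in> events" by measurable
    have "prob ?N \<le> (\<Sum>k. ?v (k + m)) / a\<^sup>2" for m
    proof -
      interpret S: martingale_differences M "\<lambda>n. F (m + n)" "\<lambda>n. D (m + n)" by (rule shifted)
      have "prob ?N \<le> prob (?E m)"
        by (intro finite_measure_mono) auto
      also have "\<dots> \<le> (\<Sum>k. ?v (m + k)) / a\<^sup>2"
        using summable_ignore_initial_segment[OF sum, of m]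
        by (intro S.maximal_inequality_infinite[OF a]) (simp add: add.commute)
      finally show ?thesis by (simp add: add.commute)
    qed
    moreover have "(\<lambda>m. (\<Sum>k. ?v (k + m)) / a\<^sup>2) \<longlonglongrightarrow> 0 / a\<^sup>2"
      using suminf_exist_split2[OF sum] a by (intro tendsto_divide tendsto_const) auto
    ultimately have "prob ?N \<le> 0"
      by (intro LIMSEQ_le_const) auto
    then have "prob ?N = 0" by (simp add: order.antisym)
    then have "AE \<omega> in M. \<omega> \<notin> ?N"
      using N by (simp add: prob_eq_0)
    then show ?thesis by (elim AE_mp) (auto intro!: AE_I2 simp: not_le)
  qed
  have "AE \<omega> in M. \<forall>j. \<exists>m. \<forall>n. \<bar>?S m n \<omega>\<bar> < 1 / real (Suc j)"
    unfolding AE_all_countable using small by simp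
  then show ?thesis
  proof eventually_elim
    case (elim \<omega>)
    show ?case
      unfolding summable_Cauchy
    proof (intro allI impI)
      fix e :: real assume "0 < e"
      then obtain j where j: "1 / real (Suc j) < e / 2"
        using nat_approx_posE[of "e / 2"] by auto
      obtain m where m: "\<And>n. \<bar>?S m n \<omega>\<bar> < 1 / real (Suc j)" using elim by blast
      have *: "\<bar>\<Sum>k\<in>{m..<n}. D k \<omega>\<bar> < e / 2" for n
      proof (cases "m \<le> n")
        case True
        have "(\<Sum>k\<in>{m..<n}. D k \<omega>) = ?S m (n - m) \<omega>"
          using True sum.shift_bounds_nat_ivl[of "\<lambda>k. D k \<omega>" 0 m "n - m"]
          by (simp add: atLeast0LessThan add.commute)
        then show ?thesis using m[of "n - m"] j by simp
      qed (use \<open>0 < e\<close> in simp)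
      have "norm (\<Sum>k\<in>{i..<n}. D k \<omega>) < e" if "m \<le> i" for i n
      proof (cases "i \<le> n")
        case True
        have "(\<Sum>k\<in>{m..<n}. D k \<omega>) = (\<Sum>k\<in>{m..<i}. D k \<omega>) + (\<Sum>k\<in>{i..<n}. D k \<omega>)"
          using that True by (simp add: sum.atLeastLessThan_concat)
        then show ?thesis using *[of i] *[of n] by (simp only: real_norm_def)
      qed (use \<open>0 < e\<close> in simp)
      then show "\<exists>N. \<forall>i\<ge>N. \<forall>n. norm (\<Sum>k\<in>{i..<n}. D k \<omega>) < e" by blast
    qed
  qed
qed

end

section \<open>Moment bounds\<close>

lemma AE_summable_weighted:
  fixes a :: "nat \<Rightarrow> real" and f :: "nat \<Rightarrow> 'a \<Rightarrow> real"
  assumes f [measurable]: "\<And>n. f n \<in> borel_measurable M" and f_nonneg: "\<And>n \<omega>. 0 \<le> f n \<omega>"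
    and bound: "\<And>n. (\<integral>\<^sup>+\<omega>. ennreal (f n \<omega>) \<partial>M) \<le> ennreal R"
    and a_nonneg: "\<And>n. 0 \<le> a n" and a: "summable a"
  shows "AE \<omega> in M. summable (\<lambda>n. a n * f n \<omega>)"
proof -
  have R: "\<exists>R'\<ge>0. \<forall>n. (\<integral>\<^sup>+\<omega>. ennreal (f n \<omega>) \<partial>M) \<le> ennreal R'"
    using bound by (intro exI[of _ "max R 0"]) (auto intro: order.trans ennreal_leI)
  then obtain R' where R': "0 \<le> R'" "\<And>n. (\<integral>\<^sup>+\<omega>. ennreal (f n \<omega>) \<partial>M) \<le> ennreal R'" by blast
  have "(\<integral>\<^sup>+\<omega>. (\<Sum>n. ennreal (a n * f n \<omega>)) \<partial>M) = (\<Sum>n. \<integral>\<^sup>+\<omega>. ennreal (a n * f n \<omega>) \<partial>M)"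
    by (intro nn_integral_suminf) simp
  also have "\<dots> \<le> (\<Sum>n. ennreal (a n * R'))"
  proof (intro suminf_le summableI)
    fix n
    have "(\<integral>\<^sup>+\<omega>. ennreal (a n * f n \<omega>) \<partial>M) = ennreal (a n) * (\<integral>\<^sup>+\<omega>. ennreal (f n \<omega>) \<partial>M)"
      using a_nonneg f_nonneg by (simp add: ennreal_mult nn_integral_cmult)
    also have "\<dots> \<le> ennreal (a n) * ennreal R'"
      using R'(2) by (intro mult_left_mono) auto
    finally show "(\<integral>\<^sup>+\<omega>. ennreal (a n * f n \<omega>) \<partial>M) \<le> ennreal (a n * R')"
      using a_nonneg R' by (simp add: ennreal_mult)
  qed
  also have "\<dots> = ennreal (\<Sum>n. a n * R')"
    using a_nonneg R' a by (intro suminf_ennreal2 summable_mult2) auto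
  also have "\<dots> < \<infinity>" by simp
  finally have "AE \<omega> in M. (\<Sum>n. ennreal (a n * f n \<omega>)) \<noteq> \<infinity>"
    by (intro nn_integral_PInf_AE) auto
  then show ?thesis
  proof eventually_elim
    case (elim \<omega>)
    then show ?case using a_nonneg f_nonneg by (intro summable_suminf_not_top) auto
  qed
qed

lemma Lr_norm_powr_bound:
  assumes "0 < r" "0 \<le> R" "Lr_norm M (ennreal r) f \<le> ennreal R"
  shows "(\<integral>\<^sup>+\<omega>. ennreal (norm (f \<omega>) powr r) \<partial>M) \<le> ennreal (R powr r)"
proof -
  let ?I = "\<integral>\<^sup>+\<omega>. ennreal (norm (f \<omega>) powr r) \<partial>M"
  have fin: "?I \<noteq> \<infinity>" and le: "ennreal (enn2real ?I powr (1 / r)) \<le> ennreal R"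
    using assms by (auto simp: Lr_norm_def Let_def top_unique split: if_splits)
  have "enn2real ?I powr (1 / r) \<le> R" using le assms(2) by simp
  then have "(enn2real ?I powr (1 / r)) powr r \<le> R powr r"
    using assms by (intro powr_mono2) auto
  then have "enn2real ?I \<le> R powr r" using assms(1) by (simp add: powr_powr)
  then show ?thesis using fin
    by (metis ennreal_enn2real ennreal_leI infinity_ennreal_def less_top)
qed

lemma square_le_1_plus_powr:
  fixes x r :: real
  assumes "0 \<le> x" "2 \<le> r"
  shows "x\<^sup>2 \<le> 1 + x powr r"
proof (cases "x \<le> 1")
  case True
  then have "x\<^sup>2 \<le> 1" using assms by (simp add: power_le_one)
  then show ?thesis by (simp add: add_increasing2)
next
  case False
  then have "x powr 2 \<le> x powr r" using assms by (intro powr_mono) auto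
  then show ?thesis using False by simp
qed

text \<open>
  On a probability space the second moments are controlled by any higher norm; \<open>r = \<infinity>\<close> arises as
  the conjugate exponent of 1.
\<close>

lemma (in prob_space) Lr_norm_square_bound:
  fixes f :: "nat \<Rightarrow> 'a \<Rightarrow> 'b::real_normed_vector"
  assumes f: "\<And>n. f n \<in> borel_measurable M" and r: "2 \<le> r"
    and bound: "(SUP n. Lr_norm M r (f n)) < \<infinity>"
  shows "\<exists>R\<ge>0. \<forall>n. (\<integral>\<^sup>+\<omega>. ennreal ((norm (f n \<omega>))\<^sup>2) \<partial>M) \<le> ennreal R"
proof -
  obtain R where R: "0 \<le> R" "(SUP n. Lr_norm M r (f n)) = ennreal R"
    using bound by (cases "SUP n. Lr_norm M r (f n)") auto
  have le: "Lr_norm M r (f n) \<le> ennreal R" for n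
    unfolding R(2)[symmetric] by (rule SUP_upper) simp
  show ?thesis
  proof (cases r)
    case (real s)
    then have s: "2 \<le> s" using r by (metis ennreal_le_iff ennreal_numeral)
    have "(\<integral>\<^sup>+\<omega>. ennreal ((norm (f n \<omega>))\<^sup>2) \<partial>M) \<le> ennreal (1 + R powr s)" for n
    proof -
      have [measurable]: "f n \<in> borel_measurable M" by (rule f)
      have "(\<integral>\<^sup>+\<omega>. ennreal ((norm (f n \<omega>))\<^sup>2) \<partial>M)
          \<le> (\<integral>\<^sup>+\<omega>. 1 + ennreal (norm (f n \<omega>) powr s) \<partial>M)"
      proof (rule nn_integral_mono)
        fix \<omega>
        have "ennreal ((norm (f n \<omega>))\<^sup>2) \<le> ennreal (1 + norm (f n \<omega>) powr s)"
          using s by (intro ennreal_leI square_le_1_plus_powr) auto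
        then show "ennreal ((norm (f n \<omega>))\<^sup>2) \<le> 1 + ennreal (norm (f n \<omega>) powr s)"
          by simp
      qed
      also have "\<dots> = 1 + (\<integral>\<^sup>+\<omega>. ennreal (norm (f n \<omega>) powr s) \<partial>M)"
        by (subst nn_integral_add) (auto simp: emeasure_space_1)
      also have "\<dots> \<le> 1 + ennreal (R powr s)"
        using Lr_norm_powr_bound[of s R M "f n"] le s R(1) real by (intro add_left_mono) auto
      finally show ?thesis by simp
    qed
    then show ?thesis by (intro exI[of _ "1 + R powr s"]) (auto simp: add_increasing2)
  next
    case top
    have "(\<integral>\<^sup>+\<omega>. ennreal ((norm (f n \<omega>))\<^sup>2) \<partial>M) \<le> ennreal (R\<^sup>2)" for n
    proof -
      have [measurable]: "f n \<in> borel_measurable M" by (rule f)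
      have "AE \<omega> in M. ennreal (norm (f n \<omega>)) \<le> esssup M (\<lambda>\<omega>. ennreal (norm (f n \<omega>)))"
        by (rule esssup_AE)
      then have "AE \<omega> in M. ennreal ((norm (f n \<omega>))\<^sup>2) \<le> ennreal (R\<^sup>2)"
      proof eventually_elim
        case (elim \<omega>)
        have "esssup M (\<lambda>\<omega>. ennreal (norm (f n \<omega>))) \<le> ennreal R"
          using le[of n] top by (simp add: Lr_norm_def)
        with elim have "ennreal (norm (f n \<omega>)) \<le> ennreal R" by (rule order.trans)
        then have "norm (f n \<omega>) \<le> R" using R(1) by simp
        then show ?case by (intro ennreal_leI power_mono) auto
      qed
      then have "(\<integral>\<^sup>+\<omega>. ennreal ((norm (f n \<omega>))\<^sup>2) \<partial>M) \<le> (\<integral>\<^sup>+\<omega>. ennreal (R\<^sup>2) \<partial>M)"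
        by (rule nn_integral_mono_AE)
      then show ?thesis by (simp add: emeasure_space_1)
    qed
    then show ?thesis by (intro exI[of _ "R\<^sup>2"]) auto
  qed
qed

text \<open>
  The bound on the conditional moment of order \<open>r\<close> is used after division by \<open>S\<close>, which is known at
  the time of conditioning. The passage from order \<open>r\<close> to order 2 rests on the pointwise inequality
  \<open>x\<^sup>2 \<le> 1 + x\<^sup>r\<close>, which spares a conditional Jensen inequality.
\<close>

lemma (in prob_space) conditional_moment_square_bound:
  fixes X :: "'a \<Rightarrow> 'b::{second_countable_topology, real_normed_vector}" and S b :: "'a \<Rightarrow> real"
  assumes sub: "subalgebra M F" and X [measurable]: "X \<in> borel_measurable M"
    and S: "S \<in> borel_measurable F" and S_pos: "\<And>\<omega>. 0 < S \<omega>" and r: "2 \<le> r"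
    and cond: "AE \<omega> in M. nn_cond_exp M F (\<lambda>\<omega>. ennreal (norm (X \<omega>) powr r)) \<omega> \<le> ennreal (b \<omega> * S \<omega> powr r)"
    and b: "(\<integral>\<^sup>+\<omega>. ennreal (b \<omega>) \<partial>M) \<le> ennreal R" "0 \<le> R"
  shows "(\<integral>\<^sup>+\<omega>. ennreal ((norm (X \<omega>) / S \<omega>)\<^sup>2) \<partial>M) \<le> ennreal (1 + R)"
proof -
  interpret S: finite_measure_subalgebra M F by standard (rule sub)
  note [measurable] = measurable_from_subalg[OF sub S]
  have inv: "(\<lambda>\<omega>. ennreal (1 / S \<omega> powr r)) \<in> borel_measurable F" using S by measurable
  have "(\<integral>\<^sup>+\<omega>. ennreal ((norm (X \<omega>) / S \<omega>)\<^sup>2) \<partial>M)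
      \<le> (\<integral>\<^sup>+\<omega>. 1 + ennreal (1 / S \<omega> powr r) * ennreal (norm (X \<omega>) powr r) \<partial>M)"
  proof (rule nn_integral_mono)
    fix \<omega>
    have "ennreal ((norm (X \<omega>) / S \<omega>)\<^sup>2) \<le> ennreal (1 + (norm (X \<omega>) / S \<omega>) powr r)"
      using S_pos[of \<omega>] r by (intro ennreal_leI square_le_1_plus_powr) auto
    also have "\<dots> = 1 + ennreal (1 / S \<omega> powr r) * ennreal (norm (X \<omega>) powr r)"
      using S_pos[of \<omega>] by (simp add: powr_divide ennreal_mult[symmetric])
    finally show "ennreal ((norm (X \<omega>) / S \<omega>)\<^sup>2) \<le> 1 + ennreal (1 / S \<omega> powr r) * ennreal (norm (X \<omega>) powr r)" .
  qed
  also have "\<dots> = 1 + (\<integral>\<^sup>+\<omega>. ennreal (1 / S \<omega> powr r) * ennreal (norm (X \<omega>) powr r) \<partial>M)"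
    by (subst nn_integral_add) (auto simp: emeasure_space_1)
  also have "(\<integral>\<^sup>+\<omega>. ennreal (1 / S \<omega> powr r) * ennreal (norm (X \<omega>) powr r) \<partial>M)
      = (\<integral>\<^sup>+\<omega>. ennreal (1 / S \<omega> powr r) * nn_cond_exp M F (\<lambda>\<omega>. ennreal (norm (X \<omega>) powr r)) \<omega> \<partial>M)"
    using inv by (intro S.nn_cond_exp_intg[symmetric]) auto
  also have "\<dots> \<le> (\<integral>\<^sup>+\<omega>. ennreal (b \<omega>) \<partial>M)"
  proof (rule nn_integral_mono_AE)
    from cond show "AE \<omega> in M. ennreal (1 / S \<omega> powr r) * nn_cond_exp M F (\<lambda>\<omega>. ennreal (norm (X \<omega>) powr r)) \<omega> \<le> ennreal (b \<omega>)"
    proof eventually_elim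
      case (elim \<omega>)
      have "ennreal (1 / S \<omega> powr r) * nn_cond_exp M F (\<lambda>\<omega>. ennreal (norm (X \<omega>) powr r)) \<omega>
          \<le> ennreal (1 / S \<omega> powr r) * ennreal (b \<omega> * S \<omega> powr r)"
        using elim by (rule mult_left_mono) simp
      also have "\<dots> = ennreal (1 / S \<omega> powr r * (b \<omega> * S \<omega> powr r))"
        by (rule ennreal_mult'[symmetric]) simp
      also have "\<dots> = ennreal (b \<omega>)" using S_pos[of \<omega>] by simp
      finally show ?case .
    qed
  qed
  also have "1 + (\<integral>\<^sup>+\<omega>. ennreal (b \<omega>) \<partial>M) \<le> ennreal (1 + R)"
    using b by (simp add: add_left_mono)
  finally show ?thesis by (simp add: add_left_mono)
qed

lemma (in prob_space) integrable_if_Lr_norm: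
  fixes f :: "'a \<Rightarrow> real"
  assumes [measurable]: "f \<in> borel_measurable M" and p: "1 \<le> p" and "Lr_norm M (ennreal p) f < \<infinity>"
  shows "integrable M f"
proof -
  obtain R where R: "0 \<le> R" "Lr_norm M (ennreal p) f \<le> ennreal R"
    using assms(3) by (cases "Lr_norm M (ennreal p) f") auto
  have "(\<integral>\<^sup>+\<omega>. ennreal (norm (f \<omega>)) \<partial>M) \<le> (\<integral>\<^sup>+\<omega>. 1 + ennreal (norm (f \<omega>) powr p) \<partial>M)"
  proof (rule nn_integral_mono)
    fix \<omega>
    have "norm (f \<omega>) \<le> 1 + norm (f \<omega>) powr p"
    proof (cases "norm (f \<omega>) \<le> 1")
      case False
      then have "norm (f \<omega>) powr 1 \<le> norm (f \<omega>) powr p" using p by (intro powr_mono) auto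
      then show ?thesis using False by simp
    qed (simp add: add_increasing2)
    from ennreal_leI[OF this] show "ennreal (norm (f \<omega>)) \<le> 1 + ennreal (norm (f \<omega>) powr p)"
      by simp
  qed
  also have "\<dots> = 1 + (\<integral>\<^sup>+\<omega>. ennreal (norm (f \<omega>) powr p) \<partial>M)"
    by (subst nn_integral_add) (auto simp: emeasure_space_1)
  also have "\<dots> \<le> 1 + ennreal (R powr p)"
    using Lr_norm_powr_bound[of p R M f] R p by (intro add_left_mono) auto
  also have "\<dots> < \<infinity>" by simp
  finally show ?thesis by (simp add: integrable_iff_bounded)
qed

section \<open>Almost sure convergence of the recursion\<close>

lemma partial_sums_bound_if_averaging_error:
  fixes f :: "'b \<Rightarrow> real"
  assumes \<epsilon>: "\<And>n. n \<ge> 1 \<Longrightarrow> 0 \<le> \<epsilon> n"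
    and err: "(\<lambda>n. averaging_error Y \<nu> f n \<omega>) \<in> O(\<epsilon>)"
    and mean: "(\<integral>y. f y \<partial>\<nu>) = m"
  shows "\<exists>A. \<forall>\<^sub>F n in sequentially. \<bar>\<Sum>k<n. f (Y k \<omega>) - m\<bar> \<le> A * (real n * \<epsilon> n)"
proof -
  obtain A where "\<forall>\<^sub>F n in sequentially. norm (averaging_error Y \<nu> f n \<omega>) \<le> A * norm (\<epsilon> n)"
    using landau_o.bigE[OF err] by blast
  then have "\<forall>\<^sub>F n in sequentially. \<bar>\<Sum>k<n. f (Y k \<omega>) - m\<bar> \<le> A * (real n * \<epsilon> n)"
    using eventually_ge_at_top[of 1]
  proof eventually_elim
    case (elim n)
    have "(\<Sum>k<n. f (Y k \<omega>) - m) = real n * averaging_error Y \<nu> f n \<omega>"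
      using elim(2) mean by (simp add: averaging_error_def sum_subtractf field_simps)
    then have "\<bar>\<Sum>k<n. f (Y k \<omega>) - m\<bar> = real n * norm (averaging_error Y \<nu> f n \<omega>)"
      by (simp add: abs_mult)
    also have "\<dots> \<le> real n * (A * norm (\<epsilon> n))" using elim(1) by (rule mult_left_mono) simp
    also have "\<dots> = A * (real n * \<epsilon> n)" using \<epsilon>[OF elim(2)] by simp
    finally show ?case .
  qed
  then show ?thesis by blast
qed

text \<open>
  In the proof, \<open>\<rho> n\<close> is the martingale increment relative to \<open>s (\<theta> n)\<close>, \<open>\<zeta> n\<close> bounds the
  displacement relative to \<open>\<gamma> (Suc n) * s (\<theta> n)\<close>, \<open>w n\<close> is the growth rate \<open>n \<epsilon>\<^sub>n\<close> of the centred sums,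
  and \<open>D n\<close> is the part of the descent that stems from the martingale increment.
\<close>

theorem theorem2p2:
  fixes M :: "'a measure" and F :: "nat \<Rightarrow> 'a measure"
    and Y :: "nat \<Rightarrow> 'a \<Rightarrow> real ^ 'q"
    and \<Delta>M :: "nat \<Rightarrow> 'a \<Rightarrow> real ^ 'd"
    and \<theta> :: "nat \<Rightarrow> 'a \<Rightarrow> real ^ 'd"
    and \<nu> :: "(real ^ 'q) measure"
    and p :: real and \<epsilon> \<gamma> :: "nat \<Rightarrow> real"
    and H :: "real ^ 'd \<Rightarrow> real ^ 'q \<Rightarrow> real ^ 'd"
    and h :: "real ^ 'd \<Rightarrow> real ^ 'd"
    and \<theta>s :: "real ^ 'd"
    and chi \<phi> :: "real ^ 'q \<Rightarrow> real"
    and L :: "real ^ 'd \<Rightarrow> real"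
    and gradL :: "real ^ 'd \<Rightarrow> real ^ 'd"
    and C C_h C_M :: real
  assumes prob: "prob_space M"
    and filtration: "filtration (space M) F"
    and subalg: "\<And>n. subalgebra M (F n)"
    and Y_adapted: "\<And>n. Y n \<in> borel_measurable (F n)"
    and \<Delta>M_adapted: "\<And>n. \<Delta>M (Suc n) \<in> borel_measurable (F (Suc n))"
    and \<Delta>M_integrable: "\<And>n. integrable M (\<Delta>M (Suc n))"
    and \<Delta>M_increment:
      "\<And>n i. AE \<omega> in M. real_cond_exp M (F n) (\<lambda>\<omega>. \<Delta>M (Suc n) \<omega> $ i) \<omega> = 0"
    and \<theta>0_measurable: "\<theta> 0 \<in> borel_measurable (F 0)"
    and \<theta>0_integrable: "integrable M (\<theta> 0)"
    and \<theta>0_indep: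
      "indep_random_variables M borel (\<theta> 0)
         (Pi\<^sub>M UNIV (\<lambda>_::nat. borel)) (\<lambda>\<omega> n. (Y n \<omega>, \<Delta>M (Suc n) \<omega>))"
    and \<nu>: "prob_space \<nu>" "sets \<nu> = sets borel"
    and Y_stable: "averaging M Y \<nu>"
    and p: "1 \<le> p"
    and \<epsilon>_nonneg: "\<And>n. n \<ge> 1 \<Longrightarrow> 0 \<le> \<epsilon> n"
    and \<epsilon>_lim: "\<epsilon> \<longlonglongrightarrow> 0"
    and \<epsilon>_liminf: "liminf (\<lambda>n. ereal (real n * \<epsilon> n)) > 0"
    and H_borel: "(\<lambda>(x, y). H x y) \<in> borel_measurable borel"
    and h_mean: "\<And>x. h x = (\<integral>y. H x y \<partial>\<nu>)"
    and H_decomp: "\<And>x y. H x y = chi y *\<^sub>R h x + H \<theta>s y"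
    and chi_borel: "chi \<in> borel_measurable borel"
    and chi_mean: "(\<integral>y. chi y \<partial>\<nu>) = 1"
    and chi_class: "chi \<in> averaging_class M Y \<nu> \<epsilon> p"
    and chi_bound: "(SUP n. Lr_norm M (max 2 (conj_exponent p)) (\<lambda>\<omega>. chi (Y n \<omega>))) < \<infinity>"
    and H_class: "\<And>i. (\<lambda>y. H \<theta>s y $ i) \<in> averaging_class M Y \<nu> \<epsilon> p"
    and H_bound: "(SUP n. Lr_norm M (max 2 (conj_exponent p)) (\<lambda>\<omega>. H \<theta>s (Y n \<omega>))) < \<infinity>"
    and h_lipschitz: "\<exists>K. K-lipschitz_on UNIV h"
    and h_bounded: "bounded (range h)"
    and h_zero: "h \<theta>s = 0"
    and L_nonneg: "\<And>x. 0 \<le> L x"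
    and L_grad: "\<And>x. GDERIV L x :> gradL x"
    and gradL_continuous: "continuous_on UNIV gradL"
    and gradL_lipschitz: "\<exists>K. K-lipschitz_on UNIV gradL"
    and gradL_growth: "\<And>x. (norm (gradL x))\<^sup>2 \<le> C * (1 + L x)"
    and L_coercive: "filterlim L at_top at_infinity"
    and h_growth: "\<And>x. norm (h x) \<le> C_h * sqrt (1 + L x)"
    and mean_reverting: "\<And>x. x \<noteq> \<theta>s \<Longrightarrow> inner (gradL x) (h x) > 0"
    and C_M: "0 < C_M"
    and \<phi>_borel: "\<phi> \<in> borel_measurable borel"
    and \<phi>_nonneg: "\<And>y. 0 \<le> \<phi> y"
    and \<phi>_bound: "(SUP n. Lr_norm M (max 2 (conj_exponent p)) (\<lambda>\<omega>. \<phi> (Y n \<omega>))) < \<infinity>"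
    and \<Delta>M_moment:
      "\<And>n. p > 1 \<Longrightarrow> AE \<omega> in M.
         nn_cond_exp M (F n) (\<lambda>\<omega>. ennreal (norm (\<Delta>M (Suc n) \<omega>) powr max 2 (p / (p - 1)))) \<omega>
           \<le> ennreal (C_M * \<phi> (Y n \<omega>) powr max 2 (p / (p - 1))
                 * (1 + L (\<theta> n \<omega>)) powr max 1 (p / (2 * (p - 1))))"
    and \<Delta>M_bound:
      "\<And>n. p = 1 \<Longrightarrow> AE \<omega> in M.
         norm (\<Delta>M (Suc n) \<omega>) / (1 + L (\<theta> n \<omega>)) powr (1 / 2) \<le> C_M"
    and \<gamma>_nonneg: "\<And>n. n \<ge> 1 \<Longrightarrow> 0 \<le> \<gamma> n"
    and \<gamma>_decreasing: "\<And>n. n \<ge> 1 \<Longrightarrow> \<gamma> (Suc n) \<le> \<gamma> n"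
    and \<gamma>_sum: "filterlim (\<lambda>n. \<Sum>k=1..n. \<gamma> k) at_top sequentially"
    and \<gamma>_lim: "(\<lambda>n. real n * \<epsilon> n * \<gamma> n) \<longlonglongrightarrow> 0"
    and \<gamma>_summable:
      "summable (\<lambda>n. real (Suc n) * \<epsilon> (Suc n)
          * max ((\<gamma> (Suc n))\<^sup>2) \<bar>\<gamma> (Suc (Suc n)) - \<gamma> (Suc n)\<bar>)"
    and recursion:
      "\<And>n \<omega>. \<omega> \<in> space M \<Longrightarrow>
         \<theta> (Suc n) \<omega> = \<theta> n \<omega> - \<gamma> (Suc n) *\<^sub>R (H (\<theta> n \<omega>) (Y n \<omega>) + \<Delta>M (Suc n) \<omega>)"
  shows "AE \<omega> in M. (\<lambda>n. \<theta> n \<omega>) \<longlonglongrightarrow> \<theta>s"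
proof -
  interpret prob_space M by (rule prob)
  interpret \<nu>: prob_space \<nu> by (rule \<nu>)
  obtain K where K: "K-lipschitz_on UNIV gradL" using gradL_lipschitz by blast
  obtain K' where K': "K'-lipschitz_on UNIV h" using h_lipschitz by blast
  obtain B where B: "\<And>x. norm (h x) \<le> B" using h_bounded by (auto simp: bounded_iff)
  interpret mean_reverting_field L gradL C K h \<theta>s B K'
  proof
    show "norm (gradL y - gradL x) \<le> K * norm (y - x)" for x y
      using lipschitz_onD[OF K, of y x] by (simp add: dist_norm)
    show "norm (h y - h x) \<le> K' * norm (y - x)" for x y
      using lipschitz_onD[OF K', of y x] by (simp add: dist_norm)
  qed (use L_nonneg L_grad gradL_growth L_coercive gradL_continuous B h_zero mean_reverting in auto)
  have B_nonneg: "0 \<le> B" using B[of 0] norm_ge_zero order.trans by blast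
  have F_mono: "sets (F i) \<subseteq> sets (F j)" if "i \<le> j" for i j
    using filtration.sets_F_mono[OF filtration that] .
  have F_M: "f \<in> borel_measurable (F n) \<Longrightarrow> f \<in> borel_measurable M" for n and f :: "'a \<Rightarrow> 'z::topological_space"
    using subalg by (rule measurable_from_subalg)
  have F_Suc: "f \<in> borel_measurable (F n) \<Longrightarrow> f \<in> borel_measurable (F (Suc n))" for n and f :: "'a \<Rightarrow> 'z::topological_space"
    using F_mono[of n "Suc n"] subalg by (auto simp: measurable_def subalgebra_def)

  have [measurable]: "h \<in> borel_measurable borel" "gradL \<in> borel_measurable borel" "L \<in> borel_measurable borel"
    using h_continuous gradL_continuous L_continuous by (auto intro: borel_measurable_continuous_onI)
  have [measurable]: "H \<theta>s \<in> borel_measurable borel"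
  proof -
    have "(\<lambda>y. (\<theta>s, y)) \<in> borel_measurable borel"
      by (intro borel_measurable_continuous_onI continuous_intros)
    from measurable_compose[OF this H_borel] show ?thesis by simp
  qed
  note [measurable] = chi_borel \<phi>_borel
  have grad_ln_measurable [measurable]: "grad_ln \<in> borel_measurable borel"
    unfolding grad_ln_def[abs_def] by measurable
  have s_measurable [measurable]: "s \<in> borel_measurable borel"
    unfolding s_def[abs_def] by measurable
  have \<theta>_adapted: "\<theta> n \<in> borel_measurable (F n)" for n
  proof (induction n)
    case (Suc n)
    note [measurable] = F_Suc[OF Suc] F_Suc[OF Y_adapted[of n]] \<Delta>M_adapted[of n]
    have "(\<lambda>\<omega>. \<theta> n \<omega> - \<gamma> (Suc n) *\<^sub>R (chi (Y n \<omega>) *\<^sub>R h (\<theta> n \<omega>) + H \<theta>s (Y n \<omega>) + \<Delta>M (Suc n) \<omega>))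
        \<in> borel_measurable (F (Suc n))"
      by measurable
    then show ?case
    proof (rule measurable_cong[THEN iffD1, rotated])
      fix \<omega> assume "\<omega> \<in> space (F (Suc n))"
      then have "\<omega> \<in> space M" using subalg[of "Suc n"] by (simp add: subalgebra_def)
      from recursion[OF this, of n]
      show "\<theta> n \<omega> - \<gamma> (Suc n) *\<^sub>R (chi (Y n \<omega>) *\<^sub>R h (\<theta> n \<omega>) + H \<theta>s (Y n \<omega>) + \<Delta>M (Suc n) \<omega>) = \<theta> (Suc n) \<omega>"
        by (simp only: H_decomp[of "\<theta> n \<omega>" "Y n \<omega>"])
    qed
  qed (rule \<theta>0_measurable)
  note [measurable] = F_M[OF \<theta>_adapted] F_M[OF Y_adapted] F_M[OF \<Delta>M_adapted]

  define r where "r = max 2 (p / (p - 1))"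
  have exponent: "max 2 (conj_exponent p) = ennreal r" "2 \<le> r" if "1 < p"
  proof -
    show "max 2 (conj_exponent p) = ennreal r"
      using that ennreal_numeral[of "num.Bit0 num.One"]
      by (auto simp: conj_exponent_def r_def max_def ennreal_le_iff simp flip: ennreal_numeral)
    show "2 \<le> r" by (simp add: r_def)
  qed
  define \<rho> where "\<rho> n \<omega> = norm (\<Delta>M (Suc n) \<omega>) / s (\<theta> n \<omega>)" for n \<omega>
  have \<rho>_measurable [measurable]: "\<rho> n \<in> borel_measurable M" for n
    unfolding \<rho>_def[abs_def] by measurable
  have \<rho>_nonneg: "0 \<le> \<rho> n \<omega>" for n \<omega>
    using s_pos[of "\<theta> n \<omega>"] by (simp add: \<rho>_def)
  \<comment> \<open>For \<open>p = 1\<close> the relative increment is bounded by \<open>C_M\<close>. For \<open>p > 1\<close> the exponent of \<open>1 + L\<close>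
    in the moment condition is \<open>r / 2\<close>, so the condition is one on the moment of order \<open>r\<close> of
    the increment relative to \<open>s\<close>.\<close>
  have \<rho>_moment: "\<exists>R\<ge>0. \<forall>n. (\<integral>\<^sup>+\<omega>. ennreal ((\<rho> n \<omega>)\<^sup>2) \<partial>M) \<le> ennreal R"
  proof (cases "p = 1")
    case True
    have "(\<integral>\<^sup>+\<omega>. ennreal ((\<rho> n \<omega>)\<^sup>2) \<partial>M) \<le> ennreal (C_M\<^sup>2)" for n
    proof -
      from \<Delta>M_bound[OF True, of n] have "AE \<omega> in M. ennreal ((\<rho> n \<omega>)\<^sup>2) \<le> ennreal (C_M\<^sup>2)"
      proof eventually_elim
        case (elim \<omega>)
        then have "\<rho> n \<omega> \<le> C_M"
          using L_nonneg[of "\<theta> n \<omega>"] by (simp add: \<rho>_def s_def powr_half_sqrt)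
        then show ?case using \<rho>_nonneg[of n \<omega>] by (intro ennreal_leI power_mono) auto
      qed
      then have "(\<integral>\<^sup>+\<omega>. ennreal ((\<rho> n \<omega>)\<^sup>2) \<partial>M) \<le> (\<integral>\<^sup>+\<omega>. ennreal (C_M\<^sup>2) \<partial>M)"
        by (rule nn_integral_mono_AE)
      then show ?thesis by (simp add: emeasure_space_1)
    qed
    then show ?thesis by (intro exI[of _ "C_M\<^sup>2"]) auto
  next
    case False
    with p have p1: "1 < p" by simp
    obtain R where R: "0 \<le> R" "(SUP n. Lr_norm M (ennreal r) (\<lambda>\<omega>. \<phi> (Y n \<omega>))) = ennreal R"
      using \<phi>_bound exponent[OF p1] by (cases "SUP n. Lr_norm M (ennreal r) (\<lambda>\<omega>. \<phi> (Y n \<omega>))") auto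
    have "(\<integral>\<^sup>+\<omega>. ennreal ((\<rho> n \<omega>)\<^sup>2) \<partial>M) \<le> ennreal (1 + C_M * R powr r)" for n
      unfolding \<rho>_def
    proof (rule conditional_moment_square_bound[OF subalg[of n] F_M[OF \<Delta>M_adapted] _ s_pos exponent(2)[OF p1]])
      show "(\<lambda>\<omega>. s (\<theta> n \<omega>)) \<in> borel_measurable (F n)"
        using measurable_compose[OF \<theta>_adapted s_measurable] .
      have "(1 + L x) powr max 1 (p / (2 * (p - 1))) = s x powr r" for x
      proof -
        have "p / (2 * (p - 1)) = (p / (p - 1)) / 2" by simp
        moreover have "max 1 (q / 2) = max 2 q / 2" for q :: real by (simp add: max_def)
        ultimately have "max 1 (p / (2 * (p - 1))) = r / 2" by (simp only: r_def)
        then show ?thesis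
          using L_nonneg[of x] by (simp only: s_def powr_half_sqrt[symmetric] powr_powr) simp
      qed
      then show "AE \<omega> in M. nn_cond_exp M (F n) (\<lambda>\<omega>. ennreal (norm (\<Delta>M (Suc n) \<omega>) powr r)) \<omega>
          \<le> ennreal (C_M * \<phi> (Y n \<omega>) powr r * s (\<theta> n \<omega>) powr r)"
        using \<Delta>M_moment[OF p1, of n] by (simp add: r_def)
      have le: "Lr_norm M (ennreal r) (\<lambda>\<omega>. \<phi> (Y n \<omega>)) \<le> ennreal R"
        unfolding R(2)[symmetric] by (rule SUP_upper) simp
      have "(\<integral>\<^sup>+\<omega>. ennreal (C_M * \<phi> (Y n \<omega>) powr r) \<partial>M)
          = ennreal C_M * (\<integral>\<^sup>+\<omega>. ennreal (norm (\<phi> (Y n \<omega>)) powr r) \<partial>M)"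
        using C_M \<phi>_nonneg by (simp add: ennreal_mult nn_integral_cmult)
      also have "\<dots> \<le> ennreal C_M * ennreal (R powr r)"
        using Lr_norm_powr_bound[OF _ R(1) le] exponent(2)[OF p1] by (intro mult_left_mono) auto
      finally show "(\<integral>\<^sup>+\<omega>. ennreal (C_M * \<phi> (Y n \<omega>) powr r) \<partial>M) \<le> ennreal (C_M * R powr r)"
        using C_M by (simp add: ennreal_mult)
      show "0 \<le> C_M * R powr r" using C_M by simp
    qed
    then show ?thesis using C_M by (intro exI[of _ "1 + C_M * R powr r"]) auto
  qed

  define \<zeta> where "\<zeta> n \<omega> = \<bar>chi (Y n \<omega>)\<bar> * B + norm (H \<theta>s (Y n \<omega>)) + \<rho> n \<omega>" for n \<omega>
  have \<zeta>_measurable [measurable]: "\<zeta> n \<in> borel_measurable M" for n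
    unfolding \<zeta>_def[abs_def] by measurable
  have \<zeta>_nonneg: "0 \<le> \<zeta> n \<omega>" for n \<omega>
    using B_nonneg \<rho>_nonneg[of n \<omega>] by (simp add: \<zeta>_def)
  obtain R where R: "0 \<le> R" "\<And>n. (\<integral>\<^sup>+\<omega>. ennreal ((\<zeta> n \<omega>)\<^sup>2) \<partial>M) \<le> ennreal R"
  proof -
    have two_le: "2 \<le> max 2 (conj_exponent p)" by simp
    obtain Rc where Rc: "0 \<le> Rc" "\<And>n. (\<integral>\<^sup>+\<omega>. ennreal ((norm (chi (Y n \<omega>)))\<^sup>2) \<partial>M) \<le> ennreal Rc"
      using Lr_norm_square_bound[OF _ two_le chi_bound] by (auto simp: F_M[OF Y_adapted])
    obtain RH where RH: "0 \<le> RH" "\<And>n. (\<integral>\<^sup>+\<omega>. ennreal ((norm (H \<theta>s (Y n \<omega>)))\<^sup>2) \<partial>M) \<le> ennreal RH"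
      using Lr_norm_square_bound[OF _ two_le H_bound] by auto
    obtain R\<rho> where R\<rho>: "0 \<le> R\<rho>" "\<And>n. (\<integral>\<^sup>+\<omega>. ennreal ((\<rho> n \<omega>)\<^sup>2) \<partial>M) \<le> ennreal R\<rho>"
      using \<rho>_moment by blast
    have "(\<integral>\<^sup>+\<omega>. ennreal ((\<zeta> n \<omega>)\<^sup>2) \<partial>M) \<le> ennreal (3 * B\<^sup>2 * Rc + 3 * RH + 3 * R\<rho>)" for n
    proof -
      have "(\<zeta> n \<omega>)\<^sup>2 \<le> 3 * B\<^sup>2 * (norm (chi (Y n \<omega>)))\<^sup>2 + 3 * (norm (H \<theta>s (Y n \<omega>)))\<^sup>2 + 3 * (\<rho> n \<omega>)\<^sup>2" for \<omega>
      proof -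
        have "(a + b + c)\<^sup>2 \<le> 3 * a\<^sup>2 + 3 * b\<^sup>2 + 3 * c\<^sup>2" for a b c :: real
          using zero_le_power2[of "a - b"] zero_le_power2[of "b - c"] zero_le_power2[of "a - c"]
          by (simp add: power2_eq_square algebra_simps)
        from this[of "\<bar>chi (Y n \<omega>)\<bar> * B" "norm (H \<theta>s (Y n \<omega>))" "\<rho> n \<omega>"]
        show ?thesis by (simp add: \<zeta>_def power_mult_distrib mult_ac)
      qed
      then have "(\<integral>\<^sup>+\<omega>. ennreal ((\<zeta> n \<omega>)\<^sup>2) \<partial>M)
          \<le> (\<integral>\<^sup>+\<omega>. ennreal (3 * B\<^sup>2 * (norm (chi (Y n \<omega>)))\<^sup>2 + 3 * (norm (H \<theta>s (Y n \<omega>)))\<^sup>2 + 3 * (\<rho> n \<omega>)\<^sup>2) \<partial>M)"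
        by (intro nn_integral_mono ennreal_leI)
      also have "\<dots> = (\<integral>\<^sup>+\<omega>. ennreal (3 * B\<^sup>2) * ennreal ((norm (chi (Y n \<omega>)))\<^sup>2)
               + ennreal 3 * ennreal ((norm (H \<theta>s (Y n \<omega>)))\<^sup>2) + ennreal 3 * ennreal ((\<rho> n \<omega>)\<^sup>2) \<partial>M)"
        by (intro nn_integral_cong) (simp add: ennreal_mult)
      also have "\<dots> = ennreal (3 * B\<^sup>2) * (\<integral>\<^sup>+\<omega>. ennreal ((norm (chi (Y n \<omega>)))\<^sup>2) \<partial>M)
               + ennreal 3 * (\<integral>\<^sup>+\<omega>. ennreal ((norm (H \<theta>s (Y n \<omega>)))\<^sup>2) \<partial>M)
               + ennreal 3 * (\<integral>\<^sup>+\<omega>. ennreal ((\<rho> n \<omega>)\<^sup>2) \<partial>M)"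
        by (simp add: nn_integral_add nn_integral_cmult)
      also have "\<dots> \<le> ennreal (3 * B\<^sup>2) * ennreal Rc + ennreal 3 * ennreal RH + ennreal 3 * ennreal R\<rho>"
        using Rc(2) RH(2) R\<rho>(2) by (intro add_mono mult_left_mono) auto
      also have "\<dots> = ennreal (3 * B\<^sup>2 * Rc + 3 * RH + 3 * R\<rho>)"
        using Rc(1) RH(1) R\<rho>(1) by (simp add: ennreal_mult)
      finally show ?thesis .
    qed
    then show ?thesis using that[of "3 * B\<^sup>2 * Rc + 3 * RH + 3 * R\<rho>"] Rc(1) RH(1) R\<rho>(1) by simp
  qed
  have \<zeta>_mean: "(\<integral>\<^sup>+\<omega>. ennreal (\<zeta> n \<omega>) \<partial>M) \<le> ennreal (1 + R)" for n
  proof -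
    have "x \<le> 1 + x\<^sup>2" for x :: real
    proof -
      have "2 * x \<le> x\<^sup>2 + 1" using sum_squares_bound[of x 1] by simp
      moreover have "0 \<le> x\<^sup>2" by simp
      ultimately show ?thesis by linarith
    qed
    from ennreal_leI[OF this] have "ennreal x \<le> 1 + ennreal (x\<^sup>2)" for x :: real by simp
    then have "(\<integral>\<^sup>+\<omega>. ennreal (\<zeta> n \<omega>) \<partial>M) \<le> (\<integral>\<^sup>+\<omega>. 1 + ennreal ((\<zeta> n \<omega>)\<^sup>2) \<partial>M)"
      by (intro nn_integral_mono)
    also have "\<dots> = 1 + (\<integral>\<^sup>+\<omega>. ennreal ((\<zeta> n \<omega>)\<^sup>2) \<partial>M)"
      by (subst nn_integral_add) (auto simp: emeasure_space_1)
    also have "\<dots> \<le> 1 + ennreal R" using R(2) by (rule add_left_mono)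
    finally show ?thesis using R(1) by simp
  qed

  define w where "w n = real n * \<epsilon> n" for n
  have w_nonneg: "0 \<le> w n" for n
    using \<epsilon>_nonneg[of n] by (cases "n = 0") (auto simp: w_def)
  have \<gamma>_lim': "(\<lambda>n. w n * \<gamma> n) \<longlonglongrightarrow> 0" using \<gamma>_lim by (simp add: w_def)
  have w_var: "summable (\<lambda>n. w (Suc n) * \<bar>\<gamma> (Suc (Suc n)) - \<gamma> (Suc n)\<bar>)"
    and w_sq: "summable (\<lambda>n. w (Suc n) * (\<gamma> (Suc n))\<^sup>2)"
  proof -
    have dominated: "summable (\<lambda>n. w (Suc n) * x n)"
      if "\<And>n. 0 \<le> x n" "\<And>n. x n \<le> max ((\<gamma> (Suc n))\<^sup>2) \<bar>\<gamma> (Suc (Suc n)) - \<gamma> (Suc n)\<bar>" for x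
    proof (rule summable_comparison_test'[OF \<gamma>_summable[folded w_def]])
      fix n
      show "norm (w (Suc n) * x n) \<le> w (Suc n) * max ((\<gamma> (Suc n))\<^sup>2) \<bar>\<gamma> (Suc (Suc n)) - \<gamma> (Suc n)\<bar>"
        using w_nonneg that by (simp add: abs_mult mult_left_mono)
    qed
    show "summable (\<lambda>n. w (Suc n) * \<bar>\<gamma> (Suc (Suc n)) - \<gamma> (Suc n)\<bar>)"
      by (rule dominated) auto
    show "summable (\<lambda>n. w (Suc n) * (\<gamma> (Suc n))\<^sup>2)"
      by (rule dominated) auto
  qed
  \<comment> \<open>The sequence \<open>w\<close> is eventually bounded away from 0, so \<open>w_sq\<close> dominates this series.\<close>
  have \<gamma>_sq: "summable (\<lambda>n. (\<gamma> (Suc n))\<^sup>2)"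
  proof -
    obtain c where c: "0 < c" "\<forall>\<^sub>F n in sequentially. c < w n"
    proof -
      obtain y where y: "0 < y" "y < liminf (\<lambda>n. ereal (w n))"
        using dense[OF \<epsilon>_liminf] unfolding w_def by blast
      obtain c where "0 < c" "ereal c < y"
        using y(1) by (metis ereal_dense2 ereal_less(2))
      with y(2) show ?thesis using that[of c] less_LiminfD[of "ereal c" sequentially "\<lambda>n. ereal (w n)"]
        by (auto dest: order.strict_trans)
    qed
    show ?thesis
    proof (rule summable_comparison_test_ev)
      have "\<forall>\<^sub>F n in sequentially. c < w (Suc n)" using c(2) by (simp only: eventually_sequentially_Suc[of "\<lambda>n. c < w n"])
      then show "\<forall>\<^sub>F n in sequentially. norm ((\<gamma> (Suc n))\<^sup>2) \<le> (1 / c) * (w (Suc n) * (\<gamma> (Suc n))\<^sup>2)"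
      proof eventually_elim
        case (elim n)
        then have "c * (\<gamma> (Suc n))\<^sup>2 \<le> w (Suc n) * (\<gamma> (Suc n))\<^sup>2" by (intro mult_right_mono) auto
        then show ?case using c(1) by (simp add: field_simps)
      qed
      show "summable (\<lambda>n. (1 / c) * (w (Suc n) * (\<gamma> (Suc n))\<^sup>2))" using w_sq by (rule summable_mult)
    qed
  qed
  have \<gamma>_div: "\<not> summable (\<lambda>n. \<gamma> (Suc n))"
  proof
    assume "summable (\<lambda>n. \<gamma> (Suc n))"
    then have "(\<lambda>n. \<Sum>k<n. \<gamma> (Suc k)) \<longlonglongrightarrow> (\<Sum>k. \<gamma> (Suc k))" by (rule summable_LIMSEQ)
    moreover have "(\<Sum>k<n. \<gamma> (Suc k)) = (\<Sum>k=1..n. \<gamma> k)" for n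
      by (rule sum.reindex_bij_witness[of _ "\<lambda>k. k - 1" Suc]) auto
    ultimately show False
      using not_tendsto_and_filterlim_at_infinity[OF sequentially_bot _ filterlim_at_top_imp_at_infinity[OF \<gamma>_sum]] by simp
  qed

  have AE_\<zeta>_w: "AE \<omega> in M. summable (\<lambda>n. w (Suc n) * (\<gamma> (Suc n))\<^sup>2 * \<zeta> n \<omega>)"
    using w_nonneg by (intro AE_summable_weighted[OF \<zeta>_measurable \<zeta>_nonneg \<zeta>_mean _ w_sq]) auto
  have AE_\<zeta>_sq: "AE \<omega> in M. summable (\<lambda>n. (\<gamma> (Suc n) * \<zeta> n \<omega>)\<^sup>2)"
    unfolding power_mult_distrib by (intro AE_summable_weighted[OF _ _ R(2) _ \<gamma>_sq]) auto

  define D where "D n \<omega> = \<gamma> (Suc n) * inner (grad_ln (\<theta> n \<omega>)) (\<Delta>M (Suc n) \<omega>)" for n \<omega>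
  have D_measurable [measurable]: "D n \<in> borel_measurable M" for n
    unfolding D_def[abs_def] by measurable
  have inner_bound: "norm (grad_ln (\<theta> n \<omega>)) * norm (\<Delta>M (Suc n) \<omega>) \<le> sqrt C * \<rho> n \<omega>" for n \<omega>
    using mult_right_mono[OF norm_grad_ln_le[of "\<theta> n \<omega>"] norm_ge_zero[of "\<Delta>M (Suc n) \<omega>"]]
    by (simp add: \<rho>_def)
  have \<rho>_le: "(\<rho> n \<omega>)\<^sup>2 \<le> (\<zeta> n \<omega>)\<^sup>2" for n \<omega>
    using \<rho>_nonneg[of n \<omega>] B_nonneg by (intro power_mono) (auto simp: \<zeta>_def)
  have D_sq: "(D n \<omega>)\<^sup>2 \<le> C * (\<gamma> (Suc n))\<^sup>2 * (\<zeta> n \<omega>)\<^sup>2" for n \<omega>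
  proof -
    have "\<bar>inner (grad_ln (\<theta> n \<omega>)) (\<Delta>M (Suc n) \<omega>)\<bar> \<le> sqrt C * \<rho> n \<omega>"
      using Cauchy_Schwarz_ineq2 inner_bound by (rule order.trans)
    then have "(inner (grad_ln (\<theta> n \<omega>)) (\<Delta>M (Suc n) \<omega>))\<^sup>2 \<le> (sqrt C * \<rho> n \<omega>)\<^sup>2"
      by (metis abs_ge_zero power2_abs power_mono)
    also have "\<dots> \<le> C * (\<zeta> n \<omega>)\<^sup>2"
      using \<rho>_le C_nonneg by (simp add: power_mult_distrib mult_left_mono)
    finally have "(\<gamma> (Suc n))\<^sup>2 * (inner (grad_ln (\<theta> n \<omega>)) (\<Delta>M (Suc n) \<omega>))\<^sup>2 \<le> (\<gamma> (Suc n))\<^sup>2 * (C * (\<zeta> n \<omega>)\<^sup>2)"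
      by (rule mult_left_mono) simp
    then show ?thesis by (simp add: D_def power_mult_distrib mult_ac)
  qed
  have \<zeta>_sq_int: "integrable M (\<lambda>\<omega>. (\<zeta> n \<omega>)\<^sup>2)" for n
    using R(2)[of n] by (intro integrableI_bounded) (auto simp: le_less_trans)
  have \<zeta>_sq_mean: "(\<integral>\<omega>. (\<zeta> n \<omega>)\<^sup>2 \<partial>M) \<le> R" for n
    using R(2)[of n] R(1) nn_integral_eq_integral[OF \<zeta>_sq_int[of n]] by simp
  interpret D: martingale_differences M F D
  proof
    show "subalgebra M (F n)" for n by (rule subalg)
    show "sets (F i) \<subseteq> sets (F j)" if "i \<le> j" for i j using that by (rule F_mono)
    fix n
    have "(\<lambda>\<omega>. grad_ln (\<theta> n \<omega>)) \<in> borel_measurable (F n)"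
      using measurable_compose[OF \<theta>_adapted grad_ln_measurable] .
    note adapted = this
    show "D n \<in> borel_measurable (F (Suc n))"
      unfolding D_def[abs_def] using F_Suc[OF adapted] \<Delta>M_adapted[of n] by measurable
    show "integrable M (\<lambda>\<omega>. (D n \<omega>)\<^sup>2)"
      by (rule Bochner_Integration.integrable_bound[OF integrable_mult_right[OF \<zeta>_sq_int[of n], of "C * (\<gamma> (Suc n))\<^sup>2"]])
        (use D_sq C_nonneg in \<open>auto simp: abs_mult\<close>)
    interpret S: finite_measure_subalgebra M "F n" by standard (rule subalg)
    let ?a = "\<lambda>i \<omega>. \<gamma> (Suc n) * grad_ln (\<theta> n \<omega>) $ i" and ?x = "\<lambda>i \<omega>. \<Delta>M (Suc n) \<omega> $ i"
    have nth: "(\<lambda>v :: real ^ 'd. v $ i) \<in> borel_measurable borel" for i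
      by (intro borel_measurable_continuous_onI continuous_intros)
    note [measurable] = measurable_compose[OF adapted nth] measurable_compose[OF F_M[OF \<Delta>M_adapted] nth]
      measurable_compose[OF F_M[OF adapted] nth]
    have a: "?a i \<in> borel_measurable (F n)" for i by measurable
    have x: "?x i \<in> borel_measurable M" for i by measurable
    \<comment> \<open>The weights are bounded because \<open>grad_ln\<close> is, so integrability of the increments suffices to
      pull them out of the conditional expectation.\<close>
    have int: "integrable M (\<lambda>\<omega>. ?a i \<omega> * ?x i \<omega>)" for i
    proof (rule Bochner_Integration.integrable_bound)
      show "integrable M (\<lambda>\<omega>. \<gamma> (Suc n) * sqrt C * norm (\<Delta>M (Suc n) \<omega>))"
        using \<Delta>M_integrable[of n] by simp
      have "\<bar>grad_ln (\<theta> n \<omega>) $ i\<bar> * \<bar>\<Delta>M (Suc n) \<omega> $ i\<bar> \<le> sqrt C * norm (\<Delta>M (Suc n) \<omega>)" for \<omega>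
        using component_le_norm_cart[of "grad_ln (\<theta> n \<omega>)" i] norm_grad_ln_le_sqrt_C[of "\<theta> n \<omega>"]
          component_le_norm_cart[of "\<Delta>M (Suc n) \<omega>" i] C_nonneg
        by (intro mult_mono) auto
      then show "AE \<omega> in M. norm (?a i \<omega> * ?x i \<omega>) \<le> norm (\<gamma> (Suc n) * sqrt C * norm (\<Delta>M (Suc n) \<omega>))"
        using C_nonneg by (intro AE_I2) (simp add: abs_mult mult.assoc mult_left_mono)
    qed measurable
    have "AE \<omega> in M. real_cond_exp M (F n) (\<lambda>\<omega>. \<Sum>i\<in>UNIV. ?a i \<omega> * ?x i \<omega>) \<omega>
        = (\<Sum>i\<in>UNIV. real_cond_exp M (F n) (\<lambda>\<omega>. ?a i \<omega> * ?x i \<omega>) \<omega>)"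
      by (rule S.real_cond_exp_sum) (rule int)
    moreover have "AE \<omega> in M. \<forall>i. real_cond_exp M (F n) (\<lambda>\<omega>. ?a i \<omega> * ?x i \<omega>) \<omega> = 0"
    unfolding AE_all_countable
    proof
      fix i
      from S.real_cond_exp_mult[OF a x int, of i] \<Delta>M_increment[of n i]
      show "AE \<omega> in M. real_cond_exp M (F n) (\<lambda>\<omega>. ?a i \<omega> * ?x i \<omega>) \<omega> = 0"
        by eventually_elim simp
    qed
    ultimately show "AE \<omega> in M. real_cond_exp M (F n) (D n) \<omega> = 0"
    proof eventually_elim
      case (elim \<omega>)
      have "D n = (\<lambda>\<omega>. \<Sum>i\<in>UNIV. ?a i \<omega> * ?x i \<omega>)"
        by (simp add: D_def[abs_def] inner_vec_def sum_distrib_left mult.assoc)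
      with elim show ?case by simp
    qed
  qed
  have "summable (\<lambda>n. \<integral>\<omega>. (D n \<omega>)\<^sup>2 \<partial>M)"
  proof (rule summable_comparison_test)
    have "(\<integral>\<omega>. (D n \<omega>)\<^sup>2 \<partial>M) \<le> C * R * (\<gamma> (Suc n))\<^sup>2" for n
    proof -
      have "(\<integral>\<omega>. (D n \<omega>)\<^sup>2 \<partial>M) \<le> (\<integral>\<omega>. C * (\<gamma> (Suc n))\<^sup>2 * (\<zeta> n \<omega>)\<^sup>2 \<partial>M)"
        using D_sq \<zeta>_sq_int D.D_square by (intro integral_mono) auto
      also have "\<dots> \<le> C * (\<gamma> (Suc n))\<^sup>2 * R"
        using \<zeta>_sq_mean C_nonneg by (simp add: mult_left_mono)
      finally show ?thesis by (simp add: mult_ac)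
    qed
    then show "\<exists>N. \<forall>n\<ge>N. norm (\<integral>\<omega>. (D n \<omega>)\<^sup>2 \<partial>M) \<le> C * R * (\<gamma> (Suc n))\<^sup>2" by simp
    show "summable (\<lambda>n. C * R * (\<gamma> (Suc n))\<^sup>2)" using \<gamma>_sq by (rule summable_mult)
  qed
  then have AE_D: "AE \<omega> in M. summable (\<lambda>n. D n \<omega>)" by (rule D.AE_summable)

  \<comment> \<open>Decomposition of the vector-valued mean \<open>h \<theta>s = 0\<close> into components requires integrability,
    which comes from membership in \<open>L\<^sup>p(\<nu>)\<close>.\<close>
  have H_mean: "(\<integral>y. H \<theta>s y $ i \<partial>\<nu>) = 0" for i
  proof -
    have "integrable \<nu> (\<lambda>y. H \<theta>s y $ i)" for i
      using H_class[of i] p by (intro \<nu>.integrable_if_Lr_norm[of _ p]) (auto simp: averaging_class_def)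
    then have "integrable \<nu> (\<lambda>y. \<Sum>i\<in>UNIV. \<bar>H \<theta>s y $ i\<bar>)" by simp
    then have "integrable \<nu> (H \<theta>s)"
    proof (rule Bochner_Integration.integrable_bound)
      show "H \<theta>s \<in> borel_measurable \<nu>" by (simp add: measurable_cong_sets[OF \<nu>(2) refl])
      show "AE y in \<nu>. norm (H \<theta>s y) \<le> norm (\<Sum>i\<in>UNIV. \<bar>H \<theta>s y $ i\<bar>)"
        by (intro AE_I2 order.trans[OF norm_le_l1_cart]) simp
    qed
    from integral_bounded_linear[OF bounded_linear_vec_nth this, of i]
    show ?thesis using h_mean[of \<theta>s] h_zero by simp
  qed
  have AE_chi: "AE \<omega> in M. (\<lambda>n. averaging_error Y \<nu> chi n \<omega>) \<in> O(\<epsilon>)"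
    using chi_class by (simp add: averaging_class_def)
  have AE_H: "AE \<omega> in M. \<forall>i. (\<lambda>n. averaging_error Y \<nu> (\<lambda>y. H \<theta>s y $ i) n \<omega>) \<in> O(\<epsilon>)"
    unfolding AE_all_countable using H_class by (auto simp: averaging_class_def)

  from AE_\<zeta>_w AE_\<zeta>_sq AE_D AE_chi AE_H AE_space show ?thesis
  proof eventually_elim
    case (elim \<omega>)
    have rec: "\<theta> (Suc n) \<omega> = \<theta> n \<omega> - \<gamma> (Suc n) *\<^sub>R (chi (Y n \<omega>) *\<^sub>R h (\<theta> n \<omega>) + H \<theta>s (Y n \<omega>) + \<Delta>M (Suc n) \<omega>)" for n
      using recursion[OF elim(6), of n] by (simp only: H_decomp[of "\<theta> n \<omega>" "Y n \<omega>"])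
    show ?case
    proof (rule trajectory_tendsto[OF rec _ \<gamma>_nonneg \<gamma>_decreasing \<gamma>_div \<gamma>_lim' w_var])
      show "norm (\<theta> (Suc n) \<omega> - \<theta> n \<omega>) / s (\<theta> n \<omega>) \<le> \<gamma> (Suc n) * \<zeta> n \<omega>" for n
      proof -
        let ?s = "s (\<theta> n \<omega>)"
        have "norm (chi (Y n \<omega>) *\<^sub>R h (\<theta> n \<omega>) + H \<theta>s (Y n \<omega>) + \<Delta>M (Suc n) \<omega>)
            \<le> \<bar>chi (Y n \<omega>)\<bar> * B + norm (H \<theta>s (Y n \<omega>)) + norm (\<Delta>M (Suc n) \<omega>)"
          using B[of "\<theta> n \<omega>"] by (intro norm_triangle_le add_mono) (auto intro: mult_left_mono)
        also have "\<dots> \<le> ?s * (\<bar>chi (Y n \<omega>)\<bar> * B + norm (H \<theta>s (Y n \<omega>))) + ?s * \<rho> n \<omega>"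
        proof (rule add_mono)
          show "\<bar>chi (Y n \<omega>)\<bar> * B + norm (H \<theta>s (Y n \<omega>)) \<le> ?s * (\<bar>chi (Y n \<omega>)\<bar> * B + norm (H \<theta>s (Y n \<omega>)))"
            using mult_right_mono[OF s_ge_1[of "\<theta> n \<omega>"], of "\<bar>chi (Y n \<omega>)\<bar> * B + norm (H \<theta>s (Y n \<omega>))"] B_nonneg
            by simp
          show "norm (\<Delta>M (Suc n) \<omega>) \<le> ?s * \<rho> n \<omega>"
            using s_pos[of "\<theta> n \<omega>"] by (simp add: \<rho>_def)
        qed
        also have "\<dots> = ?s * \<zeta> n \<omega>" by (simp add: \<zeta>_def algebra_simps)
        finally have "\<gamma> (Suc n) * norm (chi (Y n \<omega>) *\<^sub>R h (\<theta> n \<omega>) + H \<theta>s (Y n \<omega>) + \<Delta>M (Suc n) \<omega>)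
            \<le> \<gamma> (Suc n) * (?s * \<zeta> n \<omega>)"
          using \<gamma>_nonneg[of "Suc n"] by (intro mult_left_mono) auto
        then show ?thesis
          using \<gamma>_nonneg[of "Suc n"] s_pos[of "\<theta> n \<omega>"]
          by (simp add: rec[of n] divide_le_eq mult_ac)
      qed
      show "\<exists>A. \<forall>\<^sub>F n in sequentially. \<bar>\<Sum>k<n. chi (Y k \<omega>) - 1\<bar> \<le> A * w n"
        unfolding w_def using partial_sums_bound_if_averaging_error[OF \<epsilon>_nonneg elim(4) chi_mean] by simp
      show "\<exists>A. \<forall>\<^sub>F n in sequentially. \<bar>\<Sum>k<n. inner (H \<theta>s (Y k \<omega>)) b\<bar> \<le> A * w n" if "b \<in> Basis" for b
      proof -
        obtain i where "b = axis i 1" using \<open>b \<in> Basis\<close> by (auto simp: Basis_vec_def)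
        then show ?thesis
          unfolding w_def using partial_sums_bound_if_averaging_error[OF \<epsilon>_nonneg elim(5)[rule_format, of i] H_mean]
            by (simp add: inner_axis)
      qed
    qed (use elim in \<open>auto simp: D_def\<close>)
  qed
qed

end
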